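(* Let $V$ be a vector space over a field $\mathbb{K}$, and let $\mathcal{M}ag(V)$ be the free magmatic algebra generated by $V$. Then $\mathcal{L}ie(\mathcal{M}ag(V))$, with its commutator bracket $[-,-]$ and the product $*$ extending the product of $\mathcal{M}ag(V)$, is the free post-Lie algebra generated by $V$: for any post-Lie algebra $L$ and any linear map $\phi:V\longrightarrow L$, there is a unique morphism of post-Lie algebras $\mathcal{L}ie(\mathcal{M}ag(V))\longrightarrow L$ extending $\phi$.
   Context: A magmatic algebra is a vector space with a bilinear product (no axiom). A (right) post-Lie algebra is a triple $(\mathfrak{g},\{-,-\},* )$ where $(\mathfrak{g},\{-,-\})$ is a Lie algebra and $*$ is a bilinear product on $\mathfrak{g}$ such that for all $x,y,z\in\mathfrak{g}$: $x*\{y,z\}=(x*y)*z-x*(y*z)-(x*z)*y+x*(z*y)$ and $\{x,y\}*z=\{x*z,y\}+\{x,y*z\}$. Morphisms of post-Lie algebras are linear maps compatible with the bracket and with the second product. For a magmatic algebra $(W,* )$, $T(W)$ is the tensor algebra with concatenation product (written by juxtaposition), unit $1$, deshuffling coproduct $\Delta_{sh}$ (the algebra morphism with $\Delta_{sh}(x)=x\otimes 1+1\otimes x$ for $x\in W$; Sweedler notation $\Delta_{sh}(h)=\sum h^{(1)}\otimes h^{(2)}$) and counit $\varepsilon$. The product $*$ of $W$ extends uniquely to a bilinear map $T(W)\otimes T(W)\to T(W)$ such that for all $f,g,h\in T(W)$, $x,y\in W$: $f*1=f$; $1*f=\varepsilon(f)1$; $x*(fy)=(x*f)*y-x*(f*y)$;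 $(fg)*h=\sum (f*h^{(1)})(g*h^{(2)})$. $\mathcal{L}ie(W)$ is the Lie subalgebra of $T(W)$ generated by $W$ for $[f,g]=fg-gf$; it is stable under $*$, and $(\mathcal{L}ie(W),[-,-],* )$ is a post-Lie algebra. *)

theory Defs
  imports Complex_Main "HOL-Library.Poly_Mapping" "HOL-Library.Product_Plus" "HOL-Library.FuncSet"
begin

section \<open>Magmatic, Lie and post-Lie algebras\<close>

definition bilinear_on ::
  "('k::field \<Rightarrow> 'a::ab_group_add \<Rightarrow> 'a) \<Rightarrow> 'a set \<Rightarrow> ('a \<Rightarrow> 'a \<Rightarrow> 'a) \<Rightarrow> bool" where
  "bilinear_on scale A p \<longleftrightarrow>
     (\<forall>x\<in>A. \<forall>y\<in>A. p x y \<in> A) \<and>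
     (\<forall>x\<in>A. \<forall>y\<in>A. \<forall>z\<in>A. p (x + y) z = p x z + p y z) \<and>
     (\<forall>x\<in>A. \<forall>y\<in>A. \<forall>z\<in>A. p x (y + z) = p x y + p x z) \<and>
     (\<forall>c. \<forall>x\<in>A. \<forall>y\<in>A. p (scale c x) y = scale c (p x y)) \<and>
     (\<forall>c. \<forall>x\<in>A. \<forall>y\<in>A. p x (scale c y) = scale c (p x y))"

text \<open>All algebras live on a subspace \<open>A\<close> of an ambient vector space; the operations are
  only constrained on \<open>A\<close>.\<close>

locale magmatic_algebra = vector_space scale
  for scale :: "'k::field \<Rightarrow> 'a::ab_group_add \<Rightarrow> 'a" +
  fixes A :: "'a set" and star :: "'a \<Rightarrow> 'a \<Rightarrow> 'a"
  assumes carrier_subspace: "subspace A"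
    and star_bilinear: "bilinear_on scale A star"

locale lie_algebra = vector_space scale
  for scale :: "'k::field \<Rightarrow> 'a::ab_group_add \<Rightarrow> 'a" +
  fixes A :: "'a set" and bracket :: "'a \<Rightarrow> 'a \<Rightarrow> 'a"
  assumes lie_carrier_subspace: "subspace A"
    and bracket_bilinear: "bilinear_on scale A bracket"
    and bracket_alternating: "x \<in> A \<Longrightarrow> bracket x x = 0"
    and jacobi: "x \<in> A \<Longrightarrow> y \<in> A \<Longrightarrow> z \<in> A \<Longrightarrow>
      bracket x (bracket y z) + bracket y (bracket z x) + bracket z (bracket x y) = 0"

locale post_lie_algebra =
  lie_algebra scale A bracket + magmatic_algebra scale A star
  for scale :: "'k::field \<Rightarrow> 'a::ab_group_add \<Rightarrow> 'a"
    and A :: "'a set" and bracket :: "'a \<Rightarrow> 'a \<Rightarrow> 'a" and star :: "'a \<Rightarrow> 'a \<Rightarrow> 'a" +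
  assumes star_bracket: "x \<in> A \<Longrightarrow> y \<in> A \<Longrightarrow> z \<in> A \<Longrightarrow>
      star x (bracket y z) =
        star (star x y) z - star x (star y z) - star (star x z) y + star x (star z y)"
    and bracket_star: "x \<in> A \<Longrightarrow> y \<in> A \<Longrightarrow> z \<in> A \<Longrightarrow>
      star (bracket x y) z = bracket (star x z) y + bracket x (star y z)"

definition linear_on ::
  "('k::field \<Rightarrow> 'a::ab_group_add \<Rightarrow> 'a) \<Rightarrow> ('k \<Rightarrow> 'b::ab_group_add \<Rightarrow> 'b) \<Rightarrow>
   'a set \<Rightarrow> 'b set \<Rightarrow> ('a \<Rightarrow> 'b) \<Rightarrow> bool" where
  "linear_on scaleA scaleB A B F \<longleftrightarrow>
     F \<in> A \<rightarrow> B \<and>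
     (\<forall>x\<in>A. \<forall>y\<in>A. F (x + y) = F x + F y) \<and>
     (\<forall>c. \<forall>x\<in>A. F (scaleA c x) = scaleB c (F x))"

definition compatible_on ::
  "'a set \<Rightarrow> ('a \<Rightarrow> 'a \<Rightarrow> 'a) \<Rightarrow> ('b \<Rightarrow> 'b \<Rightarrow> 'b) \<Rightarrow> ('a \<Rightarrow> 'b) \<Rightarrow> bool" where
  "compatible_on A p q F \<longleftrightarrow> (\<forall>x\<in>A. \<forall>y\<in>A. F (p x y) = q (F x) (F y))"

definition post_lie_morphism ::
  "('k::field \<Rightarrow> 'a::ab_group_add \<Rightarrow> 'a) \<Rightarrow> 'a set \<Rightarrow> ('a \<Rightarrow> 'a \<Rightarrow> 'a) \<Rightarrow> ('a \<Rightarrow> 'a \<Rightarrow> 'a) \<Rightarrow>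
   ('k \<Rightarrow> 'b::ab_group_add \<Rightarrow> 'b) \<Rightarrow> 'b set \<Rightarrow> ('b \<Rightarrow> 'b \<Rightarrow> 'b) \<Rightarrow> ('b \<Rightarrow> 'b \<Rightarrow> 'b) \<Rightarrow>
   ('a \<Rightarrow> 'b) \<Rightarrow> bool" where
  "post_lie_morphism scaleA A bracketA starA scaleB B bracketB starB F \<longleftrightarrow>
     linear_on scaleA scaleB A B F \<and>
     compatible_on A bracketA bracketB F \<and> compatible_on A starA starB F"


section \<open>Finitely supported functions as vector spaces\<close>

text \<open>\<open>'x \<Rightarrow>\<^sub>0 'k\<close> is the vector space with basis \<open>'x\<close>, and \<open>supported X\<close> its subspace with
  basis \<open>X\<close>.\<close>

definition smul :: "'k::field \<Rightarrow> ('x \<Rightarrow>\<^sub>0 'k) \<Rightarrow> ('x \<Rightarrow>\<^sub>0 'k)" where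
  "smul c = Poly_Mapping.map ((*) c)"

definition supported :: "'x set \<Rightarrow> ('x \<Rightarrow>\<^sub>0 'k::field) set" where
  "supported X = {f. Poly_Mapping.keys f \<subseteq> X}"

definition lin_ext ::
  "('k::field \<Rightarrow> 'a::ab_group_add \<Rightarrow> 'a) \<Rightarrow> ('x \<Rightarrow> 'a) \<Rightarrow> ('x \<Rightarrow>\<^sub>0 'k) \<Rightarrow> 'a" where
  "lin_ext scale \<phi> f = (\<Sum>x\<in>Poly_Mapping.keys f. scale (Poly_Mapping.lookup f x) (\<phi> x))"

section \<open>The tensor algebra\<close>

text \<open>With lists forming a monoid under concatenation, the convolution product on
  \<open>'x list \<Rightarrow>\<^sub>0 'k\<close> is the concatenation product of the tensor algebra of the vector space with
  basis \<open>'x\<close>; its unit \<open>1\<close> is the empty word.\<close>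

instantiation list :: (type) monoid_add
begin
definition zero_list :: "'a list" where "zero_list = []"
definition plus_list :: "'a list \<Rightarrow> 'a list \<Rightarrow> 'a list" where "plus_list = (@)"
instance by standard (simp_all add: zero_list_def plus_list_def)
end

type_synonym ('k, 'x) tensor = "'x list \<Rightarrow>\<^sub>0 'k"

definition tensor_algebra :: "'x set \<Rightarrow> ('k::field, 'x) tensor set" where
  "tensor_algebra X = supported (lists X)"

definition emb :: "('x \<Rightarrow>\<^sub>0 'k::field) \<Rightarrow> ('k, 'x) tensor" where
  "emb = lin_ext smul (\<lambda>x. Poly_Mapping.single [x] 1)"

definition counit :: "('k::field, 'x) tensor \<Rightarrow> 'k" where
  "counit f = Poly_Mapping.lookup f []"

text \<open>The tensor square of \<open>T(W)\<close> has the pairs of words as a basis, \<open>(u, v)\<close> standing for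
  \<open>u \<otimes> v\<close>; its algebra structure is the convolution product of the product monoid.\<close>

definition deshuffle :: "('k::field, 'x) tensor \<Rightarrow> 'x list \<times> 'x list \<Rightarrow>\<^sub>0 'k" where
  "deshuffle = lin_ext smul
     (\<lambda>w. \<Prod>x\<leftarrow>w. Poly_Mapping.single ([x], []) 1 + Poly_Mapping.single ([], [x]) 1)"

text \<open>\<open>W = supported X\<close> with the product \<open>mul\<close> is a magmatic algebra, included in \<open>T(W)\<close> by
  \<open>emb\<close>. The last condition is \<open>(f g) * h = \<Sum> (f * h\<^sup>(\<^sup>1\<^sup>)) (g * h\<^sup>(\<^sup>2\<^sup>))\<close>. The extension exists and is
  unique on \<open>T(W)\<close>: see \<open>star_extension_star_ext\<close> and \<open>star_ext_unique\<close> below.\<close>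

definition star_extension ::
  "'x set \<Rightarrow> (('x \<Rightarrow>\<^sub>0 'k::field) \<Rightarrow> ('x \<Rightarrow>\<^sub>0 'k) \<Rightarrow> ('x \<Rightarrow>\<^sub>0 'k)) \<Rightarrow>
   (('k, 'x) tensor \<Rightarrow> ('k, 'x) tensor \<Rightarrow> ('k, 'x) tensor) \<Rightarrow> bool" where
  "star_extension X mul star \<longleftrightarrow>
     (let W = supported X; T = tensor_algebra X in
      bilinear_on smul T star \<and>
      (\<forall>x\<in>W. \<forall>y\<in>W. star (emb x) (emb y) = emb (mul x y)) \<and>
      (\<forall>f\<in>T. star f 1 = f) \<and>
      (\<forall>f\<in>T. star 1 f = smul (counit f) 1) \<and>
      (\<forall>x\<in>W. \<forall>f\<in>T. \<forall>y\<in>W.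
         star (emb x) (f * emb y) = star (star (emb x) f) (emb y) - star (emb x) (star f (emb y))) \<and>
      (\<forall>f\<in>T. \<forall>g\<in>T. \<forall>h\<in>T.
         star (f * g) h =
           lin_ext smul (\<lambda>(u, v). star f (Poly_Mapping.single u 1) * star g (Poly_Mapping.single v 1))
             (deshuffle h)))"

definition star_ext ::
  "'x set \<Rightarrow> (('x \<Rightarrow>\<^sub>0 'k::field) \<Rightarrow> ('x \<Rightarrow>\<^sub>0 'k) \<Rightarrow> ('x \<Rightarrow>\<^sub>0 'k)) \<Rightarrow>
   ('k, 'x) tensor \<Rightarrow> ('k, 'x) tensor \<Rightarrow> ('k, 'x) tensor" where
  "star_ext X mul = (SOME star. star_extension X mul star)"

definition commutator :: "'a::ring \<Rightarrow> 'a \<Rightarrow> 'a" where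
  "commutator f g = f * g - g * f"

text \<open>\<open>Lie(W)\<close> for \<open>W = supported X\<close>.\<close>

definition lie_generated :: "'x set \<Rightarrow> ('k::field, 'x) tensor set" where
  "lie_generated X =
     (\<lambda>S. module.subspace smul S \<and> (\<forall>f\<in>S. \<forall>g\<in>S. commutator f g \<in> S)) hull (emb ` supported X)"


section \<open>The free magmatic algebra\<close>

datatype (leaves: 'a) mtree = Leaf 'a | Node "'a mtree" "'a mtree"

text \<open>If \<open>B\<close> is a basis of \<open>V\<close>, the free magmatic algebra on \<open>V\<close> has as basis the magma of planar
  binary trees with leaves decorated by \<open>B\<close>; a vector of \<open>V\<close> is the same combination of
  one-leaf trees as it is of the elements of \<open>B\<close>. The basis-free universal property is
  \<open>mag_free\<close> below.\<close>

definition mag_trees :: "'v set \<Rightarrow> 'v mtree set" where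
  "mag_trees B = {t. leaves t \<subseteq> B}"

definition mag :: "'v set \<Rightarrow> ('v mtree \<Rightarrow>\<^sub>0 'k::field) set" where
  "mag B = supported (mag_trees B)"

definition mag_mul :: "('v mtree \<Rightarrow>\<^sub>0 'k::field) \<Rightarrow> ('v mtree \<Rightarrow>\<^sub>0 'k) \<Rightarrow> ('v mtree \<Rightarrow>\<^sub>0 'k)" where
  "mag_mul f g = lin_ext smul (\<lambda>s. lin_ext smul (\<lambda>t. Poly_Mapping.single (Node s t) 1) g) f"

definition mag_of :: "('k::field \<Rightarrow> 'v::ab_group_add \<Rightarrow> 'v) \<Rightarrow> 'v set \<Rightarrow> 'v \<Rightarrow> ('v mtree \<Rightarrow>\<^sub>0 'k)" where
  "mag_of scale B v =
     (\<Sum>b | module.representation scale B v b \<noteq> 0.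
        Poly_Mapping.single (Leaf b) (module.representation scale B v b))"

definition is_basis :: "('k::field \<Rightarrow> 'v::ab_group_add \<Rightarrow> 'v) \<Rightarrow> 'v set \<Rightarrow> bool" where
  "is_basis scale B \<longleftrightarrow> \<not> module.dependent scale B \<and> module.span scale B = UNIV"


section \<open>Linear extension and induction\<close>

lemma bilinear_onD:
  assumes "bilinear_on scale A p" "x \<in> A" "y \<in> A"
  shows "p x y \<in> A"
    and "z \<in> A \<Longrightarrow> p (x + y) z = p x z + p y z"
    and "z \<in> A \<Longrightarrow> p x (y + z) = p x y + p x z"
    and "p (scale c x) y = scale c (p x y)"
    and "p x (scale c y) = scale c (p x y)"
  using assms unfolding bilinear_on_def by blast+

lemma lookup_smul [simp]: "Poly_Mapping.lookup (smul c f) x = c * Poly_Mapping.lookup f x"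
  unfolding smul_def by transfer (simp add: when_def)

interpretation sm: vector_space "smul :: 'k::field \<Rightarrow> ('x \<Rightarrow>\<^sub>0 'k) \<Rightarrow> _"
  by unfold_locales (auto intro!: poly_mapping_eqI simp: lookup_add algebra_simps)

lemma subspace_supported: "module.subspace smul (supported X)"
  unfolding sm.subspace_def supported_def
  by (auto simp: in_keys_iff lookup_add) (metis add_0 in_keys_iff subsetD)

lemma single_in_supported: "x \<in> X \<Longrightarrow> Poly_Mapping.single x c \<in> supported X"
  by (auto simp: supported_def)

lemma supported_zero [simp]: "0 \<in> supported X"
  by (simp add: supported_def)

lemma smul_single [simp]: "smul c (Poly_Mapping.single x a) = Poly_Mapping.single x (c * a)"
  by (rule poly_mapping_eqI) (simp add: lookup_single when_def)

context vector_space
begin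

lemma lin_ext_superset:
  assumes "finite S" "Poly_Mapping.keys f \<subseteq> S"
  shows "lin_ext scale \<phi> f = (\<Sum>x\<in>S. scale (Poly_Mapping.lookup f x) (\<phi> x))"
  unfolding lin_ext_def using assms
  by (intro sum.mono_neutral_left) (auto simp: in_keys_iff)

lemma lin_ext_zero [simp]: "lin_ext scale \<phi> 0 = 0"
  by (simp add: lin_ext_def)

lemma lin_ext_add: "lin_ext scale \<phi> (f + g) = lin_ext scale \<phi> f + lin_ext scale \<phi> g"
proof -
  let ?S = "Poly_Mapping.keys f \<union> Poly_Mapping.keys g"
  have "lin_ext scale \<phi> h = (\<Sum>x\<in>?S. scale (Poly_Mapping.lookup h x) (\<phi> x))"
    if "h \<in> {f, g, f + g}" for h
    using that keys_add[of f g] by (intro lin_ext_superset) auto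
  then show ?thesis
    by (simp add: lookup_add scale_left_distrib sum.distrib)
qed

lemma lin_ext_smul: "lin_ext scale \<phi> (smul c f) = scale c (lin_ext scale \<phi> f)"
proof -
  have "lin_ext scale \<phi> (smul c f) =
      (\<Sum>x\<in>Poly_Mapping.keys f. scale (Poly_Mapping.lookup (smul c f) x) (\<phi> x))"
    by (rule lin_ext_superset) (auto simp: in_keys_iff)
  then show ?thesis
    by (simp add: lin_ext_def scale_sum_right)
qed

lemma lin_ext_single [simp]: "lin_ext scale \<phi> (Poly_Mapping.single x c) = scale c (\<phi> x)"
  by (subst lin_ext_superset[of "{x}"]) auto

lemma lin_ext_fun_add: "lin_ext scale (\<lambda>x. \<phi> x + \<psi> x) f = lin_ext scale \<phi> f + lin_ext scale \<psi> f"
  by (simp add: lin_ext_def scale_right_distrib sum.distrib)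

lemma lin_ext_fun_smul: "lin_ext scale (\<lambda>x. scale c (\<phi> x)) f = scale c (lin_ext scale \<phi> f)"
  by (simp add: lin_ext_def scale_sum_right mult.commute)

lemma lin_ext_in_subspace:
  assumes "subspace A" "\<And>x. x \<in> Poly_Mapping.keys f \<Longrightarrow> \<phi> x \<in> A"
  shows "lin_ext scale \<phi> f \<in> A"
  unfolding lin_ext_def using assms by (intro subspace_sum subspace_scale) auto

end

lemma lin_ext_cong:
  "(\<And>x. x \<in> Poly_Mapping.keys f \<Longrightarrow> \<phi> x = \<psi> x) \<Longrightarrow> lin_ext s \<phi> f = lin_ext s \<psi> f"
  by (simp add: lin_ext_def)

lemma lin_ext_singles: "lin_ext smul (\<lambda>x. Poly_Mapping.single x 1) f = f"
proof (rule poly_mapping_eqI)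
  fix y
  have "Poly_Mapping.lookup (lin_ext smul (\<lambda>x. Poly_Mapping.single x 1) f) y =
      (\<Sum>x\<in>Poly_Mapping.keys f. if x = y then Poly_Mapping.lookup f x else 0)"
    by (auto simp: lin_ext_def lookup_sum lookup_single when_def intro!: sum.cong)
  then show "Poly_Mapping.lookup (lin_ext smul (\<lambda>x. Poly_Mapping.single x 1) f) y =
      Poly_Mapping.lookup f y"
    by (simp add: in_keys_iff)
qed

lemma supported_induct [consumes 1, case_names zero single add smul]:
  fixes f :: "'x \<Rightarrow>\<^sub>0 'k::field"
  assumes f: "f \<in> supported X"
    and zero: "P 0"
    and single: "\<And>x. x \<in> X \<Longrightarrow> P (Poly_Mapping.single x 1)"
    and add: "\<And>f g. f \<in> supported X \<Longrightarrow> g \<in> supported X \<Longrightarrow> P f \<Longrightarrow> P g \<Longrightarrow> P (f + g)"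
    and smul: "\<And>c f. f \<in> supported X \<Longrightarrow> P f \<Longrightarrow> P (smul c f)"
  shows "P f"
proof -
  let ?A = "{f \<in> supported X. P f}"
  have sub: "sm.subspace ?A"
    using subspace_supported[of X] zero add smul by (auto simp: sm.subspace_def)
  have "lin_ext smul (\<lambda>x. Poly_Mapping.single x 1) f \<in> ?A"
    using f single by (intro sm.lin_ext_in_subspace[OF sub])
      (auto simp: supported_def single_in_supported)
  then show ?thesis by (simp add: lin_ext_singles)
qed

lemma (in vector_space) linear_on_supported:
  assumes f: "f \<in> supported X"
    and "\<And>a b. a \<in> supported X \<Longrightarrow> b \<in> supported X \<Longrightarrow> F (a + b) = F a + F b"
    and "\<And>c a. a \<in> supported X \<Longrightarrow> F (smul c a) = scale c (F a)"
  shows "F f = lin_ext scale (\<lambda>x. F (Poly_Mapping.single x 1)) f"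
proof -
  have "F 0 = 0" using assms(3)[of 0 0] by simp
  with f show ?thesis
    by (induction f rule: supported_induct) (simp_all add: assms(2,3) lin_ext_add lin_ext_smul)
qed

lemmas pm_induct [case_names zero single add smul] =
  supported_induct[where X = UNIV, simplified supported_def, simplified]


section \<open>Existence and uniqueness of the extended product\<close>

lemma star_extensionD:
  assumes "star_extension X mul star"
  shows "bilinear_on smul (tensor_algebra X) star"
    and "x \<in> supported X \<Longrightarrow> y \<in> supported X \<Longrightarrow> star (emb x) (emb y) = emb (mul x y)"
    and "f \<in> tensor_algebra X \<Longrightarrow> star f 1 = f"
    and "f \<in> tensor_algebra X \<Longrightarrow> star 1 f = smul (counit f) 1"
    and "x \<in> supported X \<Longrightarrow> f \<in> tensor_algebra X \<Longrightarrow> y \<in> supported X \<Longrightarrow>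
      star (emb x) (f * emb y) = star (star (emb x) f) (emb y) - star (emb x) (star f (emb y))"
    and "f \<in> tensor_algebra X \<Longrightarrow> g \<in> tensor_algebra X \<Longrightarrow> h \<in> tensor_algebra X \<Longrightarrow>
      star (f * g) h =
        lin_ext smul (\<lambda>(u, v). star f (Poly_Mapping.single u 1) * star g (Poly_Mapping.single v 1))
          (deshuffle h)"
  using assms unfolding star_extension_def Let_def by blast+

lemma tensor_one: "1 = Poly_Mapping.single [] (1::'k::field)"
  by (metis single_one zero_list_def)

lemma smul_mult_left [simp]: "smul c f * g = smul c (f * g)"
  for f g :: "'m::monoid_add \<Rightarrow>\<^sub>0 'k::field"
  by (simp add: smul_def mult_map_scale_conv_mult mult.assoc)

lemma smul_mult_right [simp]: "f * smul c g = smul c (f * g)"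
  for f g :: "'m::monoid_add \<Rightarrow>\<^sub>0 'k::field"
proof -
  have c: "smul c h = Poly_Mapping.single 0 c * h" for h :: "'m \<Rightarrow>\<^sub>0 'k"
    by (simp add: smul_def mult_map_scale_conv_mult)
  have "f * Poly_Mapping.single 0 c = smul c f"
    by (induction f rule: pm_induct)
      (simp_all add: mult_single distrib_right sm.scale_right_distrib mult.commute)
  then show ?thesis
    by (metis c mult.assoc)
qed

lemma supported_mult:
  assumes "f \<in> supported A" "g \<in> supported C" "\<And>a c. a \<in> A \<Longrightarrow> c \<in> C \<Longrightarrow> a + c \<in> D"
  shows "f * g \<in> supported D"
  using keys_mult[of f g] assms by (fastforce simp: supported_def)

lemma lin_ext_linear_comp:
  assumes "\<And>a b. T (a + b) = T a + T b" "\<And>c a. T (smul c a) = smul c (T a)"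
  shows "T (lin_ext smul \<phi> f) = lin_ext smul (\<lambda>x. T (\<phi> x)) f"
proof -
  have "T 0 = 0" using assms(2)[of 0 0] by simp
  then show ?thesis
    by (induction f rule: pm_induct) (simp_all add: sm.lin_ext_add sm.lin_ext_smul assms)
qed

lemma emb_add [simp]: "emb (f + g) = emb f + emb g"
  and emb_smul [simp]: "emb (smul c f) = smul c (emb f)"
  and emb_single [simp]: "emb (Poly_Mapping.single x c) = Poly_Mapping.single [x] c"
  and emb_zero [simp]: "emb 0 = 0"
  and emb_minus: "emb (f - g) = emb f - emb g"
proof -
  show *: "emb (f + g) = emb f + emb g" for f g by (simp add: emb_def sm.lin_ext_add)
  show "emb (smul c f) = smul c (emb f)" by (simp add: emb_def sm.lin_ext_smul)
  show "emb (Poly_Mapping.single x c) = Poly_Mapping.single [x] c" by (simp add: emb_def)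
  show "emb 0 = 0" by (simp add: emb_def)
  show "emb (f - g) = emb f - emb g" using *[of "f - g" g] by simp
qed

lemma emb_in_supported:
  assumes "f \<in> supported X" shows "emb f \<in> supported {w \<in> lists X. length w = 1}"
  unfolding emb_def using assms
  by (intro sm.lin_ext_in_subspace[OF subspace_supported] single_in_supported) (auto simp: supported_def)

text \<open>Sums over the deshufflings of a word, in the linear form \<open>\<Sum> H(w\<^sup>(\<^sup>1\<^sup>), w\<^sup>(\<^sup>2\<^sup>))\<close>.\<close>

definition desh_word :: "'x list \<Rightarrow> 'x list \<times> 'x list \<Rightarrow>\<^sub>0 'k::field" where
  "desh_word w = (\<Prod>x\<leftarrow>w. Poly_Mapping.single ([x], []) 1 + Poly_Mapping.single ([], [x]) 1)"

definition dsum :: "('x list \<Rightarrow> 'x list \<Rightarrow> ('y \<Rightarrow>\<^sub>0 'k::field)) \<Rightarrow> 'x list \<Rightarrow> ('y \<Rightarrow>\<^sub>0 'k)" where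
  "dsum H w = lin_ext smul (\<lambda>(u, v). H u v) (desh_word w)"

lemma lin_ext_shift:
  "lin_ext smul \<phi> (Poly_Mapping.single p 1 * f) = lin_ext smul (\<lambda>q. \<phi> (p + q)) f"
  by (induction f rule: pm_induct)
    (simp_all add: distrib_left mult_single sm.lin_ext_add sm.lin_ext_smul)

lemma dsum_Nil [simp]:
  fixes H :: "'a list \<Rightarrow> 'a list \<Rightarrow> 'y \<Rightarrow>\<^sub>0 'b::field"
  shows "dsum H [] = H [] []"
proof -
  have one: "(1 :: 'a list \<times> 'a list \<Rightarrow>\<^sub>0 'b::field) = Poly_Mapping.single ([], []) 1"
    by (metis single_one zero_list_def zero_prod_def)
  show ?thesis by (simp add: dsum_def desh_word_def one del: single_one)
qed

lemma dsum_Cons: "dsum H (x # w) = dsum (\<lambda>u v. H (x # u) v) w + dsum (\<lambda>u v. H u (x # v)) w"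
  by (simp add: dsum_def desh_word_def distrib_right sm.lin_ext_add lin_ext_shift
      case_prod_unfold fst_add snd_add plus_list_def)

lemma dsum_add: "dsum (\<lambda>u v. H u v + G u v) w = dsum H w + dsum G w"
  by (simp add: dsum_def case_prod_unfold sm.lin_ext_fun_add)

lemma dsum_add_fun: "dsum (\<lambda>u v. H u v + G u v) = (\<lambda>w. dsum H w + dsum G w)"
  by (rule ext) (rule dsum_add)

lemma dsum_smul_fun: "dsum (\<lambda>u v. smul c (H u v)) = (\<lambda>w. smul c (dsum H w))"
  by (rule ext) (simp add: dsum_def case_prod_unfold sm.lin_ext_fun_smul)

lemma dsum_zero [simp]: "dsum (\<lambda>u v. 0) w = 0"
  by (induction w) (simp_all add: dsum_Cons)

lemma dsum_cong:
  assumes "\<And>u v. length u + length v = length w \<Longrightarrow> set u \<subseteq> set w \<Longrightarrow> set v \<subseteq> set w \<Longrightarrow> H u v = G u v"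
  shows "dsum H w = dsum G w"
  using assms
proof (induction w arbitrary: H G)
  case (Cons x w)
  have "dsum (\<lambda>u v. H (x # u) v) w = dsum (\<lambda>u v. G (x # u) v) w"
    by (rule Cons.IH) (rule Cons.prems, auto)
  moreover have "dsum (\<lambda>u v. H u (x # v)) w = dsum (\<lambda>u v. G u (x # v)) w"
    by (rule Cons.IH) (rule Cons.prems, auto)
  ultimately show ?case by (simp add: dsum_Cons)
qed simp

lemma dsum_linear:
  assumes "\<And>a b. T (a + b) = T a + T b"
  shows "T (dsum H w) = dsum (\<lambda>u v. T (H u v)) w"
  by (induction w arbitrary: H) (simp_all add: dsum_Cons assms)

lemma dsum_coassoc:
  "dsum (\<lambda>u v. dsum (\<lambda>a b. G a b v) u) w = dsum (\<lambda>a t. dsum (\<lambda>b v. G a b v) t) w"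
  by (induction w arbitrary: G) (simp_all add: dsum_Cons dsum_add algebra_simps)

lemma dsum_counit:
  fixes H :: "'a list \<Rightarrow> 'b \<Rightarrow>\<^sub>0 'c::field"
  shows "dsum (\<lambda>u v. if u = [] then H v else 0) w = H w"
    and "dsum (\<lambda>u v. if v = [] then H u else 0) w = H w"
proof -
  show "dsum (\<lambda>u v. if u = [] then H v else 0) w = H w"
    by (induction w arbitrary: H) (simp_all add: dsum_Cons)
  show "dsum (\<lambda>u v. if v = [] then H u else 0) w = H w"
    by (induction w arbitrary: H) (simp_all add: dsum_Cons)
qed

lemma dsum_in_subspace:
  assumes "module.subspace smul A"
    "\<And>u v. length u + length v = length w \<Longrightarrow> set u \<subseteq> set w \<Longrightarrow> set v \<subseteq> set w \<Longrightarrow> H u v \<in> A"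
  shows "dsum H w \<in> A"
  using assms(2)
proof (induction w arbitrary: H)
  case (Cons x w)
  have "dsum (\<lambda>u v. H (x # u) v) w \<in> A"
    by (rule Cons.IH) (rule Cons.prems, auto)
  moreover have "dsum (\<lambda>u v. H u (x # v)) w \<in> A"
    by (rule Cons.IH) (rule Cons.prems, auto)
  ultimately show ?case using assms(1) by (simp add: dsum_Cons sm.subspace_add)
qed simp

lemma deshuffle_sum:
  "lin_ext smul (\<lambda>(u, v). H u v) (deshuffle h) = lin_ext smul (dsum H) h"
  unfolding deshuffle_def desh_word_def[symmetric]
  by (induction h rule: pm_induct) (simp_all add: sm.lin_ext_add sm.lin_ext_smul dsum_def)


lemma counit_linear: "counit (f + g) = counit f + counit g" "counit (smul c f) = c * counit f"
   "counit (Poly_Mapping.single w 1) = (if w = [] then 1 else 0)"  "counit 0 = 0"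
  by (auto simp: counit_def lookup_add lookup_single when_def)

text \<open>Existence of the extension, by recursion on words. On basis elements,
  \<open>word_der\<close> is \<open>u * y\<close>, \<open>word_act\<close> is \<open>x * w\<close> and \<open>word_star\<close> is \<open>u * w\<close>, for \<open>x\<close>, \<open>y\<close> letters and
  \<open>u\<close>, \<open>w\<close> words.\<close>

context
  fixes mul :: "('x \<Rightarrow>\<^sub>0 'k::field) \<Rightarrow> ('x \<Rightarrow>\<^sub>0 'k) \<Rightarrow> ('x \<Rightarrow>\<^sub>0 'k)"
begin

definition letter_mul :: "'x \<Rightarrow> 'x \<Rightarrow> 'x \<Rightarrow>\<^sub>0 'k" where
  "letter_mul x y = mul (Poly_Mapping.single x 1) (Poly_Mapping.single y 1)"

primrec word_der :: "'x list \<Rightarrow> 'x \<Rightarrow> ('k, 'x) tensor" where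
  "word_der [] y = 0"
| "word_der (x # u) y = emb (letter_mul x y) * Poly_Mapping.single u 1
     + Poly_Mapping.single [x] 1 * word_der u y"

primrec act_aux :: "nat \<Rightarrow> 'x \<Rightarrow> 'x list \<Rightarrow> 'x \<Rightarrow>\<^sub>0 'k" where
  "act_aux 0 x w = Poly_Mapping.single x 1"
| "act_aux (Suc n) x w = lin_ext smul (\<lambda>z. letter_mul z (last w)) (act_aux n x (butlast w))
     - lin_ext smul (act_aux n x) (word_der (butlast w) (last w))"

definition word_act :: "'x \<Rightarrow> 'x list \<Rightarrow> 'x \<Rightarrow>\<^sub>0 'k" where
  "word_act x w = act_aux (length w) x w"

primrec word_star :: "'x list \<Rightarrow> 'x list \<Rightarrow> ('k, 'x) tensor" where
  "word_star [] w = (if w = [] then 1 else 0)"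
| "word_star (x # u) w = dsum (\<lambda>p q. emb (word_act x p) * word_star u q) w"

definition tensor_star :: "('k, 'x) tensor \<Rightarrow> ('k, 'x) tensor \<Rightarrow> ('k, 'x) tensor" where
  "tensor_star f h = lin_ext smul (\<lambda>u. lin_ext smul (word_star u) h) f"

lemma word_der_supported:
  assumes "\<And>x y. x \<in> X \<Longrightarrow> y \<in> X \<Longrightarrow> letter_mul x y \<in> supported X"
    and "u \<in> lists X" "y \<in> X"
  shows "word_der u y \<in> supported {w \<in> lists X. length w = length u}"
  using assms(2)
proof (induction u)
  case Nil
  then show ?case by (simp add: supported_def)
next
  case (Cons x u)
  have "emb (letter_mul x y) * Poly_Mapping.single u 1 \<in> supported {w \<in> lists X. length w = length (x # u)}"
    using Cons.hyps
    by (intro supported_mult[OF emb_in_supported[OF assms(1)] single_in_supported[where X="{u}"]])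
      (auto simp: plus_list_def assms Cons.hyps)
  moreover have "Poly_Mapping.single [x] 1 * word_der u y \<in> supported {w \<in> lists X. length w = length (x # u)}"
    using Cons.hyps
    by (intro supported_mult[OF single_in_supported[where X="{[x]}"] Cons.IH])
      (auto simp: plus_list_def)
  ultimately show ?case
    unfolding word_der.simps by (rule sm.subspace_add[OF subspace_supported])
qed

lemma word_act_Nil [simp]: "word_act x [] = Poly_Mapping.single x 1"
  by (simp add: word_act_def)

lemma word_act_snoc: "word_act x (u @ [y]) =
   lin_ext smul (\<lambda>z. letter_mul z y) (word_act x u) - lin_ext smul (word_act x) (word_der u y)"
proof -
  have "word_der u y \<in> supported {w \<in> lists UNIV. length w = length u}"
    by (rule word_der_supported) (auto simp: supported_def)
  then have "lin_ext smul (act_aux (length u) x) (word_der u y) = lin_ext smul (word_act x) (word_der u y)"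
    by (intro lin_ext_cong) (auto simp: word_act_def supported_def)
  then show ?thesis by (simp add: word_act_def)
qed

lemma word_act_supported:
  assumes "\<And>x y. x \<in> X \<Longrightarrow> y \<in> X \<Longrightarrow> letter_mul x y \<in> supported X"
    and "x \<in> X" "w \<in> lists X"
  shows "word_act x w \<in> supported X"
  using assms(3)
proof (induction "length w" arbitrary: w)
  case 0
  then show ?case by (simp add: single_in_supported assms)
next
  case (Suc n)
  then obtain u y where w: "w = u @ [y]" by (metis length_Suc_conv_rev)
  have u: "u \<in> lists X" "y \<in> X" "n = length u" using Suc w by auto
  have "lin_ext smul (\<lambda>z. letter_mul z y) (word_act x u) \<in> supported X"
    using Suc.hyps(1)[OF u(3) u(1)] assms u
    by (intro sm.lin_ext_in_subspace[OF subspace_supported]) (auto simp: supported_def)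
  moreover have "lin_ext smul (word_act x) (word_der u y) \<in> supported X"
    using word_der_supported[OF assms(1) u(1,2)] u(3)
    by (intro sm.lin_ext_in_subspace[OF subspace_supported] Suc.hyps(1)) (auto simp: supported_def)
  ultimately show ?case
    unfolding w word_act_snoc using subspace_supported by (intro sm.subspace_diff) auto
qed

lemma word_star_Nil_right [simp]: "word_star u [] = Poly_Mapping.single u 1"
  by (induction u) (simp_all add: tensor_one mult_single plus_list_def del: single_one)

lemma word_star_letter_right: "word_star u [y] = word_der u y"
  by (induction u) (simp_all add: dsum_Cons letter_mul_def word_act_snoc[of _ "[]", simplified])

lemma word_star_letter_left [simp]: "word_star [x] w = emb (word_act x w)"
proof -
  have "word_star [x] w = dsum (\<lambda>p q. if q = [] then emb (word_act x p) else 0) w"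
    by (simp del: dsum_Nil) (rule dsum_cong, auto)
  then show ?thesis by (simp add: dsum_counit)
qed

lemma word_star_append: "word_star (u @ u') w = dsum (\<lambda>p q. word_star u p * word_star u' q) w"
proof (induction u arbitrary: w)
  case Nil
  have "word_star u' w = dsum (\<lambda>p q. if p = [] then word_star u' q else 0) w"
    by (simp add: dsum_counit)
  also have "\<dots> = dsum (\<lambda>p q. word_star [] p * word_star u' q) w"
    by (rule dsum_cong) auto
  finally show ?case by simp
next
  case (Cons x u)
  have "word_star ((x # u) @ u') w =
      dsum (\<lambda>a t. dsum (\<lambda>b v. emb (word_act x a) * word_star u b * word_star u' v) t) w"
    by (simp add: Cons.IH dsum_linear[where T = "\<lambda>z. emb _ * z"] distrib_left mult.assoc)
  also have "\<dots> = dsum (\<lambda>p v. dsum (\<lambda>a b. emb (word_act x a) * word_star u b * word_star u' v) p) w"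
    by (rule dsum_coassoc[symmetric])
  also have "\<dots> = dsum (\<lambda>p q. word_star (x # u) p * word_star u' q) w"
    by (simp add: dsum_linear[where T = "\<lambda>z. z * _"] distrib_right)
  finally show ?case .
qed

lemma word_star_letter: "word_star [x] = (\<lambda>w. emb (word_act x w))"
  by (rule ext) (rule word_star_letter_left)

declare word_star.simps(2) [simp del]

lemma tensor_star_linear [simp]:
  "tensor_star (f + g) h = tensor_star f h + tensor_star g h"
  "tensor_star h (f + g) = tensor_star h f + tensor_star h g"
  "tensor_star (smul c f) h = smul c (tensor_star f h)"
  "tensor_star h (smul c f) = smul c (tensor_star h f)"
  "tensor_star 0 h = 0" "tensor_star h 0 = 0"
  "tensor_star (Poly_Mapping.single u 1) (Poly_Mapping.single w 1) = word_star u w"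
proof -
  show add: "tensor_star h (f + g) = tensor_star h f + tensor_star h g" for f g h
    by (simp add: tensor_star_def sm.lin_ext_add sm.lin_ext_fun_add)
  show smul: "tensor_star h (smul c f) = smul c (tensor_star h f)" for c f h
    by (simp add: tensor_star_def sm.lin_ext_smul sm.lin_ext_fun_smul)
  show "tensor_star h 0 = 0" using smul[of h 0 0] by simp
qed (simp_all add: tensor_star_def sm.lin_ext_add sm.lin_ext_smul)

lemma tensor_star_diff_right: "tensor_star h (f - g) = tensor_star h f - tensor_star h g"
  by (metis add_diff_cancel_right' diff_add_cancel tensor_star_linear(2))

lemma tensor_star_lin_ext:
  "tensor_star (Poly_Mapping.single u 1) h = lin_ext smul (word_star u) h"
  "tensor_star f (Poly_Mapping.single w 1) = lin_ext smul (\<lambda>u. word_star u w) f"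
  by (simp_all add: tensor_star_def)

lemma word_star_in_tensor:
  assumes m: "\<And>x y. x \<in> X \<Longrightarrow> y \<in> X \<Longrightarrow> letter_mul x y \<in> supported X"
    and "u \<in> lists X" "w \<in> lists X"
  shows "word_star u w \<in> tensor_algebra X"
  using assms(2,3)
proof (induction u arbitrary: w)
  case Nil
  then show ?case
    using subspace_supported[of "lists X"]
    by (auto simp: tensor_algebra_def tensor_one single_in_supported sm.subspace_0 simp del: single_one)
next
  case (Cons x u)
  have "emb (word_act x p) * word_star u q \<in> tensor_algebra X"
    if "set p \<subseteq> set w" "set q \<subseteq> set w" for p q
  proof -
    have p: "p \<in> lists X" "q \<in> lists X" using that Cons.prems by auto
    show ?thesis
      unfolding tensor_algebra_def
      by (rule supported_mult[OF emb_in_supported[OF word_act_supported[OF m Cons.hyps(1) p(1)]]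
            Cons.IH[OF p(2), unfolded tensor_algebra_def]]) (auto simp: plus_list_def)
  qed
  then show ?case
    by (simp add: word_star.simps(2) dsum_in_subspace tensor_algebra_def subspace_supported)
qed

lemma tensor_star_in_tensor:
  assumes "\<And>x y. x \<in> X \<Longrightarrow> y \<in> X \<Longrightarrow> letter_mul x y \<in> supported X"
    and "f \<in> tensor_algebra X" "h \<in> tensor_algebra X"
  shows "tensor_star f h \<in> tensor_algebra X"
proof -
  have k: "u \<in> lists X" if "f \<in> tensor_algebra X" "u \<in> Poly_Mapping.keys f" for u and f :: "('k, 'x) tensor"
    using that by (auto simp: tensor_algebra_def supported_def)
  show ?thesis
    unfolding tensor_star_def tensor_algebra_def
    by (intro sm.lin_ext_in_subspace[OF subspace_supported])
      (rule word_star_in_tensor[OF assms(1) k[OF assms(2)] k[OF assms(3)], unfolded tensor_algebra_def])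
qed

lemma tensor_star_letters:
  "tensor_star (emb g) (Poly_Mapping.single [y] 1) = emb (lin_ext smul (\<lambda>z. letter_mul z y) g)"
  by (induction g rule: pm_induct)
    (simp_all add: sm.lin_ext_add sm.lin_ext_smul word_star_letter_right tensor_one[symmetric] del: word_star_letter_left)

lemma tensor_star_snoc:
  "tensor_star (emb x) (f * emb y) =
     tensor_star (tensor_star (emb x) f) (emb y) - tensor_star (emb x) (tensor_star f (emb y))"
proof (induction x rule: pm_induct)
  case (single x)
  show ?case
  proof (induction f rule: pm_induct)
    case (single u)
    show ?case
    proof (induction y rule: pm_induct)
      case (single y)
      have "tensor_star (Poly_Mapping.single [x] 1) (word_der u y) =
          emb (lin_ext smul (word_act x) (word_der u y))"
        by (simp add: tensor_star_lin_ext lin_ext_linear_comp[where T = emb] word_star_letter)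
      then show ?case
        by (simp add: mult_single plus_list_def word_act_snoc emb_minus tensor_star_letters
            word_star_letter_right)
    qed (simp_all add: distrib_left sm.scale_right_diff_distrib)
  qed (simp_all add: distrib_right sm.scale_right_diff_distrib)
qed (simp_all add: sm.scale_right_diff_distrib)

lemma tensor_star_mult:
  "tensor_star (f * g) h =
    lin_ext smul (\<lambda>(u, v). tensor_star f (Poly_Mapping.single u 1) * tensor_star g (Poly_Mapping.single v 1))
      (deshuffle h)"
  unfolding deshuffle_sum
proof (induction f rule: pm_induct)
  case zero
  then show ?case by (induction h rule: pm_induct) (simp_all add: sm.lin_ext_add sm.lin_ext_smul)
next
  case (single u)
  show ?case
  proof (induction g rule: pm_induct)
    case zero
    then show ?case by (induction h rule: pm_induct) (simp_all add: sm.lin_ext_add sm.lin_ext_smul)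
  next
    case (single u')
    show ?case
      by (induction h rule: pm_induct)
        (simp_all add: sm.lin_ext_add sm.lin_ext_smul mult_single plus_list_def word_star_append)
  qed (simp_all add: distrib_left sm.lin_ext_fun_add sm.lin_ext_fun_smul dsum_add_fun dsum_smul_fun)
qed (simp_all add: distrib_right sm.lin_ext_fun_add sm.lin_ext_fun_smul dsum_add_fun dsum_smul_fun)

context
  fixes X :: "'x set"
  assumes magmatic: "magmatic_algebra smul (supported X) mul"
begin

lemma mul_bilinear: "bilinear_on smul (supported X) mul"
  using magmatic by (simp add: magmatic_algebra_def magmatic_algebra_axioms_def)

lemma letter_mul_supported: "x \<in> X \<Longrightarrow> y \<in> X \<Longrightarrow> letter_mul x y \<in> supported X"
  using mul_bilinear by (auto simp: letter_mul_def bilinear_on_def single_in_supported)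

lemma mul_letter_right:
  assumes "g \<in> supported X" "y \<in> X"
  shows "mul g (Poly_Mapping.single y 1) = lin_ext smul (\<lambda>z. letter_mul z y) g"
  unfolding letter_mul_def using single_in_supported[OF assms(2), of 1]
  by (intro sm.linear_on_supported[OF assms(1), of "\<lambda>g. mul g (Poly_Mapping.single y 1)"]
      bilinear_onD[OF mul_bilinear])

lemma star_extension_tensor_star: "star_extension X mul tensor_star"
proof -
  have T: "tensor_star f h \<in> tensor_algebra X" if "f \<in> tensor_algebra X" "h \<in> tensor_algebra X" for f h
    using tensor_star_in_tensor[OF letter_mul_supported that] .
  have ext: "tensor_star (emb x) (emb y) = emb (mul x y)" if "x \<in> supported X" "y \<in> supported X" for x y
    using that(2)
  proof (induction y rule: supported_induct)
    case zero
    have "mul x (smul 0 0) = smul 0 (mul x 0)"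
      using that(1) by (intro bilinear_onD[OF mul_bilinear]) simp_all
    then show ?case by simp
  next
    case (single y)
    then show ?case by (simp add: tensor_star_letters mul_letter_right that)
  qed (use mul_bilinear that(1) in \<open>simp_all add: bilinear_on_def\<close>)
  have one_right: "tensor_star f 1 = f" for f
    unfolding tensor_one by (induction f rule: pm_induct) simp_all
  have one_word: "tensor_star 1 (Poly_Mapping.single w 1) = (if w = [] then 1 else 0)" for w
    by (simp only: tensor_one tensor_star_linear(7) word_star.simps(1))
  have one_left: "tensor_star 1 f = smul (counit f) 1" for f
    by (induction f rule: pm_induct) (simp_all add: counit_linear sm.scale_left_distrib one_word)
  show ?thesis
    unfolding star_extension_def Let_def bilinear_on_def
    by (intro conjI ballI allI T ext one_right one_left tensor_star_snoc tensor_star_mult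
        tensor_star_linear)
qed

lemma star_extension_unique:
  assumes s: "star_extension X mul star"
    and "f \<in> tensor_algebra X" "h \<in> tensor_algebra X"
  shows "star f h = tensor_star f h"
proof -
  let ?s = "\<lambda>u. Poly_Mapping.single u (1::'k)"
  note S = star_extensionD[OF s]
  note SB = bilinear_onD[OF S(1)]
  have W: "?s x \<in> supported X" if "x \<in> X" for x using that by (rule single_in_supported)
  have T: "?s u \<in> tensor_algebra X" if "u \<in> lists X" for u
    unfolding tensor_algebra_def using that by (rule single_in_supported)
  have embT: "emb x \<in> tensor_algebra X" if "x \<in> supported X" for x
    using emb_in_supported[OF that] by (auto simp: tensor_algebra_def supported_def)
  have mul: "star (?s u * ?s u') (?s w) = dsum (\<lambda>p q. star (?s u) (?s p) * star (?s u') (?s q)) w"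
    if "u \<in> lists X" "u' \<in> lists X" "w \<in> lists X" for u u' w
    using S(6)[OF T[OF that(1)] T[OF that(2)] T[OF that(3)]] by (simp add: deshuffle_sum)
  have right: "star f h = lin_ext smul (\<lambda>w. star f (?s w)) h"
    if "f \<in> tensor_algebra X" "h \<in> tensor_algebra X" for f h
    using that unfolding tensor_algebra_def
    by (intro sm.linear_on_supported[of h "lists X"] SB[unfolded tensor_algebra_def])
  have left: "star f h = lin_ext smul (\<lambda>u. star (?s u) h) f"
    if "f \<in> tensor_algebra X" "h \<in> tensor_algebra X" for f h
    using that unfolding tensor_algebra_def
    by (intro sm.linear_on_supported[of f "lists X" "\<lambda>f. star f h"] SB[unfolded tensor_algebra_def])
  have nil: "star (?s u) (?s []) = ?s u" if "u \<in> lists X" for u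
    using S(3)[OF T[OF that]] by (simp add: tensor_one del: single_one)
  have nil_left: "star (?s []) (?s w) = (if w = [] then 1 else 0)" if "w \<in> lists X" for w
    using S(4)[OF T[OF that]] by (simp add: tensor_one[symmetric] counit_linear)
  have der: "star (?s u) (?s [y]) = word_der u y" if "u \<in> lists X" "y \<in> X" for u y
    using that(1)
  proof (induction u)
    case Nil
    then show ?case using nil_left[of "[y]"] that by simp
  next
    case (Cons x u)
    have "star (?s [x]) (?s [y]) = emb (letter_mul x y)"
      using S(2)[OF W[OF Cons.hyps(1)] W[OF that(2)]] by (simp add: letter_mul_def)
    moreover have "star (?s (x # u)) (?s [y]) =
        star (?s [x]) (?s [y]) * star (?s u) (?s []) + star (?s [x]) (?s []) * star (?s u) (?s [y])"
      using mul[of "[x]" u "[y]"] Cons.hyps that by (simp add: dsum_Cons mult_single plus_list_def)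
    ultimately show ?case
      using nil[of u] nil[of "[x]"] Cons.hyps Cons.IH by simp
  qed
  have act: "star (?s [x]) (?s w) = emb (word_act x w)" if "x \<in> X" "w \<in> lists X" for x w
    using that(2)
  proof (induction "length w" arbitrary: w)
    case 0
    then show ?case using nil[of "[x]"] that(1) by simp
  next
    case (Suc n)
    then obtain u y where w: "w = u @ [y]" by (metis length_Suc_conv_rev)
    have u: "u \<in> lists X" "y \<in> X" "n = length u" using Suc w by auto
    have d: "word_der u y \<in> supported {w \<in> lists X. length w = length u}"
      by (rule word_der_supported[OF letter_mul_supported u(1,2)])
    then have dT: "word_der u y \<in> tensor_algebra X"
      by (auto simp: tensor_algebra_def supported_def)
    have a: "word_act x u \<in> supported X"
      by (rule word_act_supported[OF letter_mul_supported that(1) u(1)])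
    have "star (?s [x]) (?s w) = star (emb (?s x)) (?s u * emb (?s y))"
      by (simp add: w mult_single plus_list_def)
    also have "\<dots> = star (star (?s [x]) (?s u)) (emb (?s y)) - star (?s [x]) (star (?s u) (?s [y]))"
      using S(5)[OF W[OF that(1)] T[OF u(1)] W[OF u(2)]] by simp
    also have "star (star (?s [x]) (?s u)) (emb (?s y)) = emb (mul (word_act x u) (?s y))"
      using Suc.hyps(1)[OF u(3) u(1)] S(2)[OF a W[OF u(2)]] by simp
    also have "star (?s [x]) (star (?s u) (?s [y])) = lin_ext smul (\<lambda>w. star (?s [x]) (?s w)) (word_der u y)"
      using der[OF u(1,2)] right[OF T[of "[x]"] dT] that(1) by simp
    also have "\<dots> = lin_ext smul (\<lambda>w. emb (word_act x w)) (word_der u y)"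
      using d u(3) by (intro lin_ext_cong Suc.hyps(1)) (auto simp: supported_def)
    also have "\<dots> = emb (lin_ext smul (word_act x) (word_der u y))"
      by (simp add: lin_ext_linear_comp[where T = emb])
    finally show ?case
      by (simp add: w word_act_snoc emb_minus mul_letter_right[OF a u(2)])
  qed
  have word: "star (?s u) (?s w) = word_star u w" if "u \<in> lists X" "w \<in> lists X" for u w
    using that
  proof (induction u arbitrary: w)
    case Nil
    then show ?case by (simp add: nil_left)
  next
    case (Cons x u)
    have "star (?s (x # u)) (?s w) = dsum (\<lambda>p q. star (?s [x]) (?s p) * star (?s u) (?s q)) w"
      using mul[of "[x]" u w] Cons.hyps Cons.prems by (simp add: mult_single plus_list_def)
    also have "\<dots> = dsum (\<lambda>p q. emb (word_act x p) * word_star u q) w"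
    proof (rule dsum_cong)
      fix p q assume "set p \<subseteq> set w" "set q \<subseteq> set w"
      then have "p \<in> lists X" "q \<in> lists X" using Cons.prems by auto
      then show "star (?s [x]) (?s p) * star (?s u) (?s q) = emb (word_act x p) * word_star u q"
        using act[OF Cons.hyps(1)] Cons.IH by simp
    qed
    finally show ?case by (simp add: word_star.simps(2))
  qed
  have k: "u \<in> lists X" if "f \<in> tensor_algebra X" "u \<in> Poly_Mapping.keys f" for u and f :: "('k, 'x) tensor"
    using that by (auto simp: tensor_algebra_def supported_def)
  have "star f h = lin_ext smul (\<lambda>u. lin_ext smul (\<lambda>w. star (?s u) (?s w)) h) f"
    unfolding left[OF assms(2,3)] 
    by (intro lin_ext_cong right[OF T[OF k[OF assms(2)]] assms(3)])
  also have "\<dots> = tensor_star f h"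
    unfolding tensor_star_def 
    by (intro lin_ext_cong word[OF k[OF assms(2)] k[OF assms(3)]])
  finally show ?thesis .
qed

end

end

theorem star_extension_star_ext:
  assumes "magmatic_algebra smul (supported X) mul"
  shows "star_extension X mul (star_ext X mul)"
  unfolding star_ext_def using star_extension_tensor_star[OF assms] by (rule someI[where P = "star_extension X mul"])

theorem star_ext_unique:
  assumes "magmatic_algebra smul (supported X) mul" "star_extension X mul star"
    and "f \<in> tensor_algebra X" "h \<in> tensor_algebra X"
  shows "star f h = star_ext X mul f h"
  using star_extension_unique[OF assms(1) _ assms(3,4)] star_extension_star_ext[OF assms(1)] assms(2)
  by metis


section \<open>Universal property of the free magmatic algebra\<close>

lemma mag_mul_linear [simp]:
  "mag_mul (f + g) h = mag_mul f h + mag_mul g h"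
  "mag_mul h (f + g) = mag_mul h f + mag_mul h g"
  "mag_mul (smul c f) h = smul c (mag_mul f h)"
  "mag_mul h (smul c f) = smul c (mag_mul h f)"
  "mag_mul 0 h = 0" "mag_mul h 0 = 0"
  "mag_mul (Poly_Mapping.single s 1) (Poly_Mapping.single t 1) = Poly_Mapping.single (Node s t) 1"
proof -
  show "mag_mul h (f + g) = mag_mul h f + mag_mul h g" for f g h
    by (simp add: mag_mul_def sm.lin_ext_add sm.lin_ext_fun_add)
  show smul: "mag_mul h (smul c f) = smul c (mag_mul h f)" for c f h
    by (simp add: mag_mul_def sm.lin_ext_smul sm.lin_ext_fun_smul)
  show "mag_mul h 0 = 0" using smul[of h 0 0] by simp
qed (simp_all add: mag_mul_def sm.lin_ext_add sm.lin_ext_smul)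

lemma mag_mul_in_mag: "f \<in> mag B \<Longrightarrow> g \<in> mag B \<Longrightarrow> mag_mul f g \<in> mag B"
  unfolding mag_def mag_mul_def
  by (intro sm.lin_ext_in_subspace[OF subspace_supported] single_in_supported)
    (auto simp: supported_def mag_trees_def)

theorem magmatic_mag: "magmatic_algebra smul (mag B) mag_mul"
proof unfold_locales
  show "sm.subspace (mag B)" unfolding mag_def by (rule subspace_supported)
  show "bilinear_on smul (mag B) mag_mul"
    unfolding bilinear_on_def by (simp add: mag_mul_in_mag)
qed

primrec tree_eval :: "('a \<Rightarrow> 'a \<Rightarrow> 'a) \<Rightarrow> ('v \<Rightarrow> 'a) \<Rightarrow> 'v mtree \<Rightarrow> 'a" where
  "tree_eval star \<phi> (Leaf v) = \<phi> v"
| "tree_eval star \<phi> (Node s t) = star (tree_eval star \<phi> s) (tree_eval star \<phi> t)"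

theorem mag_free:
  fixes scaleV :: "'k::field \<Rightarrow> 'v::ab_group_add \<Rightarrow> 'v"
    and scaleM :: "'k \<Rightarrow> 'm::ab_group_add \<Rightarrow> 'm"
  assumes V: "vector_space scaleV" and B: "is_basis scaleV B"
    and M: "magmatic_algebra scaleM M star"
    and \<phi>: "Vector_Spaces.linear scaleV scaleM \<phi>" "range \<phi> \<subseteq> M"
  shows "\<exists>!F. F \<in> extensional (mag B) \<and> linear_on smul scaleM (mag B) M F \<and>
    compatible_on (mag B) mag_mul star F \<and> (\<forall>v. F (mag_of scaleV B v) = \<phi> v)"
proof -
  interpret V: vector_space scaleV by (rule V)
  interpret M: magmatic_algebra scaleM M star by (rule M)
  interpret \<phi>: Vector_Spaces.linear scaleV scaleM \<phi> by (rule \<phi>(1))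
  note bil = bilinear_onD[OF M.star_bilinear]
  have ind: "V.independent B" and span: "v \<in> V.span B" for v
    using B by (auto simp: is_basis_def)
  have eval: "tree_eval star \<phi> t \<in> M" for t
    by (induction t) (use \<phi>(2) bil(1) in auto)
  define E where "E = lin_ext scaleM (tree_eval star \<phi>)"
  have E_M: "E f \<in> M" for f
    unfolding E_def by (rule M.lin_ext_in_subspace[OF M.carrier_subspace eval])
  have E_lin: "E (f + g) = E f + E g" "E (smul c f) = scaleM c (E f)"
      "E (Poly_Mapping.single t c) = scaleM c (tree_eval star \<phi> t)" "E 0 = 0" for f g c t
    by (simp_all add: E_def M.lin_ext_add M.lin_ext_smul)
  have star0: "star 0 x = 0" "star x 0 = 0" if "x \<in> M" for x
    using bil(4)[of 0 x 0] bil(5)[of x 0 0] that M.subspace_0[OF M.carrier_subspace] by auto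
  have E_mul: "E (mag_mul f g) = star (E f) (E g)" for f g
  proof (induction f rule: pm_induct)
    case (single s)
    show ?case
      by (induction g rule: pm_induct) (simp_all add: E_lin eval E_M star0 bil)
  qed (simp_all add: E_lin E_M star0 bil)
  have E_sum: "E (sum h S) = (\<Sum>b\<in>S. E (h b))" for h :: "'v \<Rightarrow> _" and S
    by (induction S rule: infinite_finite_induct) (simp_all add: E_lin)
  have E_of: "E (mag_of scaleV B v) = \<phi> v" for v
  proof -
    have "E (mag_of scaleV B v) =
        (\<Sum>b | V.representation B v b \<noteq> 0. \<phi> (scaleV (V.representation B v b) b))"
      by (simp add: mag_of_def E_sum E_lin \<phi>.scale)
    also have "\<dots> = \<phi> (\<Sum>b | V.representation B v b \<noteq> 0. scaleV (V.representation B v b) b)"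
      by (simp add: \<phi>.sum)
    finally show ?thesis
      by (simp add: V.sum_nonzero_representation_eq[OF ind span])
  qed
  have of_in: "mag_of scaleV B v \<in> mag B" for v
    unfolding mag_of_def mag_def using V.representation_ne_zero[of B v]
    by (intro sm.subspace_sum[OF subspace_supported] single_in_supported) (auto simp: mag_trees_def)
  have sub: "f + g \<in> mag B" "smul c f \<in> mag B" if "f \<in> mag B" "g \<in> mag B"
    for f g :: "'v mtree \<Rightarrow>\<^sub>0 'k" and c
    using that sm.subspace_add[OF subspace_supported] sm.subspace_scale[OF subspace_supported]
    unfolding mag_def by blast+
  have uniq: "G f = E f"
    if G: "linear_on smul scaleM (mag B) M G" "compatible_on (mag B) mag_mul star G"
      "\<And>v. G (mag_of scaleV B v) = \<phi> v" and f: "f \<in> mag B" for G f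
  proof -
    have tree: "G (Poly_Mapping.single t 1) = tree_eval star \<phi> t" if "t \<in> mag_trees B" for t
      using that
    proof (induction t)
      case (Leaf b)
      then have "b \<in> B" by (simp add: mag_trees_def)
      then have "mag_of scaleV B b = Poly_Mapping.single (Leaf b) 1"
        by (simp add: mag_of_def V.representation_basis[OF ind])
      then show ?case using G(3)[of b] by simp
    next
      case (Node s t)
      then have st: "s \<in> mag_trees B" "t \<in> mag_trees B" by (auto simp: mag_trees_def)
      have "G (mag_mul (Poly_Mapping.single s 1) (Poly_Mapping.single t 1)) =
          star (G (Poly_Mapping.single s 1)) (G (Poly_Mapping.single t 1))"
        using G(2) single_in_supported[OF st(1)] single_in_supported[OF st(2)]
        unfolding compatible_on_def mag_def by blast
      then show ?case using Node.IH st by simp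
    qed
    have "G f = lin_ext scaleM (\<lambda>t. G (Poly_Mapping.single t 1)) f"
      using G(1) f by (intro M.linear_on_supported[of f "mag_trees B"])
        (auto simp: mag_def linear_on_def)
    also have "\<dots> = E f"
      unfolding E_def using f tree by (intro lin_ext_cong) (auto simp: mag_def supported_def)
    finally show ?thesis .
  qed
  show ?thesis
  proof (rule ex1I[of _ "restrict E (mag B)"])
    show "restrict E (mag B) \<in> extensional (mag B) \<and>
        linear_on smul scaleM (mag B) M (restrict E (mag B)) \<and>
        compatible_on (mag B) mag_mul star (restrict E (mag B)) \<and>
        (\<forall>v. restrict E (mag B) (mag_of scaleV B v) = \<phi> v)"
      by (auto simp: linear_on_def compatible_on_def E_M E_lin E_mul E_of of_in sub mag_mul_in_mag)
  next
    fix G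
    assume "G \<in> extensional (mag B) \<and> linear_on smul scaleM (mag B) M G \<and>
        compatible_on (mag B) mag_mul star G \<and> (\<forall>v. G (mag_of scaleV B v) = \<phi> v)"
    then show "G = restrict E (mag B)"
      using uniq by (intro extensionalityI[of _ "mag B"]) auto
  qed
qed

end

theory Submission
  imports Defs
begin

text \<open>
  Primitivity of Lie polynomials makes \<open>f \<mapsto> f * h\<close> a derivation of the tensor algebra for every
  \<open>h \<in> Lie(W)\<close>. Identities involving \<open>f * h\<close> therefore reduce to the case where \<open>f\<close> is a letter,
  and then to letters \<open>h\<close> by induction on the degree of \<open>h\<close>, since
  \<open>f * [h, k] = (f * h) * k - f * (h * k) - (f * k) * h + f * (k * h)\<close> and \<open>h * k\<close>, \<open>k * h\<close> do not
  have larger degree than \<open>h\<close>, \<open>k\<close>. This gives the post-Lie axioms, and also the compatibility with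
  \<open>*\<close> of a Lie morphism that is compatible with the products of letters.

  The Lie morphism itself comes from the freeness of \<open>Lie(W)\<close>: a combination of bracketings that
  vanishes in the tensor algebra vanishes in every Lie algebra. This is proved by elimination
  of a letter \<open>a\<close>, by induction on the size of the bracketings: bracketings involving \<open>a\<close> become
  smaller bracketings of the elements \<open>ad(a)\<^sup>n(x)\<close>, which act on the tensor algebra over these new
  letters as left multiplications once \<open>a\<close> acts as the derivation \<open>ad(a)\<^sup>n(x) \<mapsto> ad(a)\<^sup>n\<^sup>+\<^sup>1(x)\<close>.
\<close>

lemma commutator_linear [simp]:
  fixes f g h :: "'m::monoid_add \<Rightarrow>\<^sub>0 'k::field"
  shows "commutator (f + g) h = commutator f h + commutator g h"
    "commutator h (f + g) = commutator h f + commutator h g"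
    "commutator (smul c f) h = smul c (commutator f h)"
    "commutator h (smul c f) = smul c (commutator h f)"
    "commutator 0 h = 0" "commutator h 0 = 0"
  by (simp_all add: commutator_def algebra_simps sm.scale_right_diff_distrib)

lemma lie_algebra_commutator:
  fixes A :: "('m::monoid_add \<Rightarrow>\<^sub>0 'k::field) set"
  assumes "sm.subspace A" "\<And>f g. f \<in> A \<Longrightarrow> g \<in> A \<Longrightarrow> commutator f g \<in> A"
  shows "lie_algebra smul A commutator"
proof unfold_locales
  show "bilinear_on smul A commutator"
    unfolding bilinear_on_def using assms(2) by simp
qed (simp_all add: assms(1), simp_all add: commutator_def algebra_simps)

context lie_algebra
begin

lemma bracket_closed: "x \<in> A \<Longrightarrow> y \<in> A \<Longrightarrow> bracket x y \<in> A"
  using bilinear_onD[OF bracket_bilinear] by blast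

lemma bracket_add_left: "x \<in> A \<Longrightarrow> y \<in> A \<Longrightarrow> z \<in> A \<Longrightarrow> bracket (x + y) z = bracket x z + bracket y z"
  and bracket_add_right: "x \<in> A \<Longrightarrow> y \<in> A \<Longrightarrow> z \<in> A \<Longrightarrow> bracket x (y + z) = bracket x y + bracket x z"
  and bracket_scale_left: "x \<in> A \<Longrightarrow> y \<in> A \<Longrightarrow> bracket (scale c x) y = scale c (bracket x y)"
  and bracket_scale_right: "x \<in> A \<Longrightarrow> y \<in> A \<Longrightarrow> bracket x (scale c y) = scale c (bracket x y)"
  using bilinear_onD[OF bracket_bilinear] by blast+

lemma bracket_zero_left: "x \<in> A \<Longrightarrow> bracket 0 x = 0"
  and bracket_zero_right: "x \<in> A \<Longrightarrow> bracket x 0 = 0"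
  using bracket_scale_left[of x x 0] bracket_scale_right[of x x 0] by simp_all

lemma bracket_antisym:
  assumes "x \<in> A" "y \<in> A"
  shows "bracket y x = - bracket x y"
proof -
  have "x + y \<in> A" using assms lie_carrier_subspace by (simp add: subspace_add)
  then have "0 = bracket (x + y) (x + y)" by (simp add: bracket_alternating)
  also have "\<dots> = bracket x y + bracket y x"
    using assms \<open>x + y \<in> A\<close> bracket_alternating[of x] bracket_alternating[of y]
    by (simp add: bracket_add_left bracket_add_right)
  finally show ?thesis by (metis add.commute add_eq_0_iff)
qed

lemma bracket_neg_right: "x \<in> A \<Longrightarrow> y \<in> A \<Longrightarrow> bracket x (- y) = - bracket x y"
  using bracket_scale_right[of x y "-1"] by simp

lemma bracket_derivation:
  assumes "x \<in> A" "y \<in> A" "z \<in> A"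
  shows "bracket x (bracket y z) = bracket (bracket x y) z + bracket y (bracket x z)"
proof -
  have "bracket x (bracket y z) = - bracket y (bracket z x) - bracket z (bracket x y)"
    using jacobi[OF assms] by (simp add: algebra_simps eq_neg_iff_add_eq_0)
  moreover have "bracket y (bracket z x) = - bracket y (bracket x z)"
    using bracket_antisym[of x z] bracket_neg_right[of y "bracket x z"] assms bracket_closed by simp
  moreover have "bracket z (bracket x y) = - bracket (bracket x y) z"
    using bracket_antisym[of "bracket x y" z] assms bracket_closed by simp
  ultimately show ?thesis by simp
qed

lemma tree_eval_closed: "(\<And>x. \<phi> x \<in> A) \<Longrightarrow> tree_eval bracket \<phi> t \<in> A"
  by (induction t) (auto intro: bracket_closed)

lemma lin_ext_tree_eval_closed:
  "(\<And>x. \<phi> x \<in> A) \<Longrightarrow> lin_ext scale (tree_eval bracket \<phi>) p \<in> A"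
  by (intro lin_ext_in_subspace lie_carrier_subspace tree_eval_closed)

lemma lin_ext_tree_eval_mag_mul:
  assumes "\<And>x. \<phi> x \<in> A"
  shows "lin_ext scale (tree_eval bracket \<phi>) (mag_mul p q) =
    bracket (lin_ext scale (tree_eval bracket \<phi>) p) (lin_ext scale (tree_eval bracket \<phi>) q)"
proof (induction p rule: pm_induct)
  case (single s)
  show ?case
    by (induction q rule: pm_induct)
      (simp_all add: lin_ext_add lin_ext_smul bracket_zero_right bracket_add_right bracket_scale_right
        lin_ext_tree_eval_closed tree_eval_closed assms)
qed (simp_all add: lin_ext_add lin_ext_smul bracket_zero_left bracket_add_left bracket_scale_left
        lin_ext_tree_eval_closed assms)

end

section \<open>Lie polynomials\<close>

definition lie_word :: "'x mtree \<Rightarrow> ('k::field, 'x) tensor" where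
  "lie_word = tree_eval commutator (\<lambda>x. Poly_Mapping.single [x] 1)"

lemma lie_word_simps [simp]:
  "lie_word (Leaf x) = Poly_Mapping.single [x] 1"
  "lie_word (Node s t) = commutator (lie_word s) (lie_word t)"
  by (simp_all add: lie_word_def)

interpretation tl: lie_algebra smul UNIV "commutator :: ('k::field, 'x) tensor \<Rightarrow> _"
  by (rule lie_algebra_commutator) simp_all

lemma lin_ext_lie_word_mag_mul:
  "lin_ext smul lie_word (mag_mul p q) = commutator (lin_ext smul lie_word p) (lin_ext smul lie_word q)"
  unfolding lie_word_def by (rule tl.lin_ext_tree_eval_mag_mul) simp

lemma lie_generated_closed:
  "sm.subspace (lie_generated X)"
  "f \<in> lie_generated X \<Longrightarrow> g \<in> lie_generated X \<Longrightarrow> commutator f g \<in> lie_generated X"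
  "x \<in> supported X \<Longrightarrow> emb x \<in> lie_generated X"
proof -
  let ?S = "\<lambda>S. sm.subspace S \<and> (\<forall>f\<in>S. \<forall>g\<in>S. commutator f g \<in> S)"
  have "?S (?S hull emb ` supported X)"
    by (rule hull_in) (auto simp: sm.subspace_Inter)
  then show "sm.subspace (lie_generated X)"
    "f \<in> lie_generated X \<Longrightarrow> g \<in> lie_generated X \<Longrightarrow> commutator f g \<in> lie_generated X"
    by (auto simp: lie_generated_def)
  show "emb x \<in> lie_generated X" if "x \<in> supported X"
    using that hull_subset[of "emb ` supported X" ?S] by (auto simp: lie_generated_def)
qed

lemma lie_generated_minimal:
  assumes "sm.subspace S" "\<And>f g. f \<in> S \<Longrightarrow> g \<in> S \<Longrightarrow> commutator f g \<in> S"
    "\<And>x. x \<in> X \<Longrightarrow> Poly_Mapping.single [x] 1 \<in> S"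
  shows "lie_generated X \<subseteq> S"
  unfolding lie_generated_def
proof (rule hull_minimal)
  show "emb ` supported X \<subseteq> S"
    unfolding emb_def using assms(1,3)
    by (auto simp: supported_def intro!: sm.lin_ext_in_subspace)
qed (use assms(1,2) in auto)

lemma lie_word_in_lie_generated: "leaves t \<subseteq> X \<Longrightarrow> lie_word t \<in> lie_generated X"
proof (induction t)
  case (Leaf x)
  then show ?case using lie_generated_closed(3)[OF single_in_supported[of x X 1]] by simp
qed (auto intro: lie_generated_closed(2))

lemma commutator_in_span:
  assumes f: "f \<in> sm.span S" and g: "g \<in> sm.span S'"
    and *: "\<And>f g. f \<in> S \<Longrightarrow> g \<in> S' \<Longrightarrow> commutator f g \<in> sm.span S''"
  shows "commutator f g \<in> sm.span S''"
  using f
proof (induction f rule: sm.span_induct_alt)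
  case (step c x y)
  have "commutator x g \<in> sm.span S''"
    using g by (induction g rule: sm.span_induct_alt)
      (simp_all add: sm.span_zero sm.span_add sm.span_scale * step.hyps)
  then show ?case using step.IH by (simp add: sm.span_add sm.span_scale)
qed (simp add: sm.span_zero)

lemma lie_generated_eq_span: "lie_generated X = sm.span (lie_word ` {t. leaves t \<subseteq> X})"
proof
  show "lie_generated X \<subseteq> sm.span (lie_word ` {t. leaves t \<subseteq> X})"
  proof (rule lie_generated_minimal)
    show "commutator f g \<in> sm.span (lie_word ` {t. leaves t \<subseteq> X})"
      if "f \<in> sm.span (lie_word ` {t. leaves t \<subseteq> X})" "g \<in> sm.span (lie_word ` {t. leaves t \<subseteq> X})" for f g
      by (rule commutator_in_span[OF that])
        (auto intro!: sm.span_base image_eqI[where x = "Node _ _"])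
    show "Poly_Mapping.single [x] 1 \<in> sm.span (lie_word ` {t. leaves t \<subseteq> X})" if "x \<in> X" for x
      using that by (intro sm.span_base image_eqI[where x = "Leaf x"]) auto
  qed simp
  show "sm.span (lie_word ` {t. leaves t \<subseteq> X}) \<subseteq> lie_generated X"
    by (rule sm.span_minimal) (auto simp: lie_generated_closed lie_word_in_lie_generated)
qed

lemma lie_generated_subset_tensor:
  "(lie_generated X :: ('k::field, 'x) tensor set) \<subseteq> tensor_algebra X"
proof (rule lie_generated_minimal)
  have mult: "f * g \<in> tensor_algebra X" if "f \<in> tensor_algebra X" "g \<in> tensor_algebra X"
    for f g :: "('k, 'x) tensor"
    using that unfolding tensor_algebra_def by (rule supported_mult) (auto simp: plus_list_def)
  show sub: "sm.subspace (tensor_algebra X :: ('k, 'x) tensor set)"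
    unfolding tensor_algebra_def by (rule subspace_supported)
  show "commutator f g \<in> tensor_algebra X" if "f \<in> tensor_algebra X" "g \<in> tensor_algebra X"
    for f g :: "('k, 'x) tensor"
    unfolding commutator_def using that by (intro sm.subspace_diff[OF sub] mult)
qed (simp add: tensor_algebra_def single_in_supported)

subsection \<open>Lie polynomials are primitive\<close>

lemma deshuffle_mult: "deshuffle (f * g) = deshuffle f * deshuffle g"
proof (induction f rule: pm_induct)
  case (single u)
  show ?case
    by (induction g rule: pm_induct)
      (simp_all add: deshuffle_def sm.lin_ext_add sm.lin_ext_smul distrib_left mult_single plus_list_def)
qed (simp_all add: deshuffle_def sm.lin_ext_add sm.lin_ext_smul distrib_right)

definition tensor_left :: "('k::field, 'x) tensor \<Rightarrow> 'x list \<times> 'x list \<Rightarrow>\<^sub>0 'k" where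
  "tensor_left = lin_ext smul (\<lambda>w. Poly_Mapping.single (w, []) 1)"

definition tensor_right :: "('k::field, 'x) tensor \<Rightarrow> 'x list \<times> 'x list \<Rightarrow>\<^sub>0 'k" where
  "tensor_right = lin_ext smul (\<lambda>w. Poly_Mapping.single ([], w) 1)"

lemma tensor_left_right_linear [simp]:
  "tensor_left (f + g) = tensor_left f + tensor_left g"
  "tensor_left (smul c f) = smul c (tensor_left f)"
  "tensor_left (Poly_Mapping.single w 1) = Poly_Mapping.single (w, []) 1"
  "tensor_left 0 = 0"
  "tensor_right (f + g) = tensor_right f + tensor_right g"
  "tensor_right (smul c f) = smul c (tensor_right f)"
  "tensor_right (Poly_Mapping.single w 1) = Poly_Mapping.single ([], w) 1"
  "tensor_right 0 = 0"
  by (simp_all add: tensor_left_def tensor_right_def sm.lin_ext_add sm.lin_ext_smul)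

lemma tensor_left_right_mult:
  "tensor_left (f * g) = tensor_left f * tensor_left g"
  "tensor_right (f * g) = tensor_right f * tensor_right g"
  "tensor_left f * tensor_right g = tensor_right g * tensor_left f"
proof -
  have "tensor_left (f * g) = tensor_left f * tensor_left g \<and>
      tensor_right (f * g) = tensor_right f * tensor_right g \<and>
      tensor_left f * tensor_right g = tensor_right g * tensor_left f"
  proof (induction f rule: pm_induct)
    case (single u)
    show ?case
      by (induction g rule: pm_induct) (simp_all add: distrib_left distrib_right mult_single plus_list_def)
  qed (simp_all add: distrib_left distrib_right)
  then show "tensor_left (f * g) = tensor_left f * tensor_left g"
    "tensor_right (f * g) = tensor_right f * tensor_right g"
    "tensor_left f * tensor_right g = tensor_right g * tensor_left f" by blast+
qed

lemma tensor_left_right_diff: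
  "tensor_left (f - g) = tensor_left f - tensor_left g"
  "tensor_right (f - g) = tensor_right f - tensor_right g"
  using tensor_left_right_linear(1)[of "f - g" g] tensor_left_right_linear(5)[of "f - g" g]
  by simp_all

lemma deshuffle_linear:
  fixes f g :: "('k::field, 'x) tensor"
  shows
  "deshuffle (f + g) = deshuffle f + deshuffle g"
  "deshuffle (smul c f) = smul c (deshuffle f)"
  "deshuffle (f - g) = deshuffle f - deshuffle g"
  "deshuffle 0 = 0"
proof -
  show add: "deshuffle (f + g) = deshuffle f + deshuffle g" for f g :: "('k, 'x) tensor"
    by (simp add: deshuffle_def sm.lin_ext_add)
  show "deshuffle (f - g) = deshuffle f - deshuffle g"
    using add[of "f - g" g] by simp
qed (simp_all add: deshuffle_def sm.lin_ext_smul)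

lemma lie_generated_primitive:
  assumes "h \<in> lie_generated X"
  shows "deshuffle h = tensor_left h + tensor_right h"
proof -
  let ?P = "{h. deshuffle h = tensor_left h + tensor_right h}"
  have "lie_generated X \<subseteq> ?P"
  proof (rule lie_generated_minimal)
    show "sm.subspace ?P"
      by (auto simp: sm.subspace_def deshuffle_linear sm.scale_right_distrib)
    show "commutator f g \<in> ?P" if "f \<in> ?P" "g \<in> ?P" for f g
      using that tensor_left_right_mult(3)[of f g] tensor_left_right_mult(3)[of g f]
      by (simp add: commutator_def deshuffle_linear deshuffle_mult tensor_left_right_diff
          tensor_left_right_mult(1,2) algebra_simps)
  qed (simp add: deshuffle_def)
  with assms show ?thesis by blast
qed

lemma tensor_star_one_right: "tensor_star mul f (Poly_Mapping.single [] 1) = f"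
  by (induction f rule: pm_induct) simp_all

lemma tensor_star_derivation:
  assumes "h \<in> lie_generated X"
  shows "tensor_star mul (f * g) h = tensor_star mul f h * g + f * tensor_star mul g h"
proof -
  let ?H = "\<lambda>(u, v). tensor_star mul f (Poly_Mapping.single u 1) * tensor_star mul g (Poly_Mapping.single v 1)"
  have "lin_ext smul ?H (tensor_left h) = tensor_star mul f h * g" for h
    by (induction h rule: pm_induct)
      (simp_all add: sm.lin_ext_add sm.lin_ext_smul distrib_right tensor_star_one_right)
  moreover have "lin_ext smul ?H (tensor_right h) = f * tensor_star mul g h" for h
    by (induction h rule: pm_induct)
      (simp_all add: sm.lin_ext_add sm.lin_ext_smul distrib_left tensor_star_one_right)
  ultimately show ?thesis
    by (simp add: tensor_star_mult lie_generated_primitive[OF assms] sm.lin_ext_add)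
qed

lemma tensor_star_diff_left: "tensor_star mul (f - g) h = tensor_star mul f h - tensor_star mul g h"
  by (metis add_diff_cancel_right' diff_add_cancel tensor_star_linear(1))

lemma tensor_star_commutator:
  assumes "h \<in> lie_generated X"
  shows "tensor_star mul (commutator f g) h =
    commutator (tensor_star mul f h) g + commutator f (tensor_star mul g h)"
  by (simp add: commutator_def tensor_star_diff_left tensor_star_derivation[OF assms])

subsection \<open>The product of Lie polynomials\<close>

lemma tensor_star_emb:
  "tensor_star mul (emb x) h = emb (lin_ext smul (\<lambda>z. lin_ext smul (word_act mul z) h) x)"
  by (induction x rule: pm_induct)
    (simp_all add: sm.lin_ext_add sm.lin_ext_smul tensor_star_lin_ext word_star_letter
      lin_ext_linear_comp[where T = emb])

lemma tensor_star_one_left: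
  assumes "h \<in> lie_generated X"
  shows "tensor_star mul 1 h = 0"
  using tensor_star_derivation[OF assms, of mul 1 1] by simp

context
  fixes mul :: "('x \<Rightarrow>\<^sub>0 'k::field) \<Rightarrow> ('x \<Rightarrow>\<^sub>0 'k) \<Rightarrow> ('x \<Rightarrow>\<^sub>0 'k)"
    and X :: "'x set"
  assumes magmatic: "magmatic_algebra smul (supported X) mul"
begin

abbreviation (input) tstar (infixl "\<star>" 75) where "f \<star> g \<equiv> tensor_star mul f g"

lemma tensor_star_emb_in_supported:
  assumes "x \<in> supported X" "h \<in> tensor_algebra X"
  obtains y where "y \<in> supported X" "emb x \<star> h = emb y"
proof
  show "lin_ext smul (\<lambda>z. lin_ext smul (word_act mul z) h) x \<in> supported X"
    using assms
    by (intro sm.lin_ext_in_subspace[OF subspace_supported] word_act_supported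
        letter_mul_supported[OF magmatic]) (auto simp: supported_def tensor_algebra_def)
qed (rule tensor_star_emb)

definition lie_filtration :: "nat \<Rightarrow> ('k, 'x) tensor set" where
  "lie_filtration n = sm.span (lie_word ` {t. leaves t \<subseteq> X \<and> size t \<le> n})"

lemma lie_word_in_filtration: "leaves t \<subseteq> X \<Longrightarrow> size t \<le> n \<Longrightarrow> lie_word t \<in> lie_filtration n"
  unfolding lie_filtration_def by (intro sm.span_base) auto

lemma commutator_in_filtration:
  assumes "f \<in> lie_filtration m" "g \<in> lie_filtration n"
  shows "commutator f g \<in> lie_filtration (Suc (m + n))"
  using assms unfolding lie_filtration_def
  by (rule commutator_in_span) (auto intro!: sm.span_base image_eqI[where x = "Node _ _"])

lemma tensor_star_in_filtration:
  assumes f: "f \<in> lie_filtration n" and h: "h \<in> lie_generated X"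
  shows "f \<star> h \<in> lie_filtration n"
proof -
  have word: "lie_word t \<star> h \<in> lie_filtration (size t)" if "leaves t \<subseteq> X" for t
    using that
  proof (induction t)
    case (Leaf x)
    then have "Poly_Mapping.single x 1 \<in> supported X" by (simp add: single_in_supported)
    moreover have "h \<in> tensor_algebra X" using h lie_generated_subset_tensor by blast
    ultimately obtain y where y: "y \<in> supported X" "emb (Poly_Mapping.single x 1) \<star> h = emb y"
      by (rule tensor_star_emb_in_supported)
    have "Poly_Mapping.single [z] 1 \<in> lie_filtration 1" if "z \<in> X" for z
      using lie_word_in_filtration[of "Leaf z" 1] that by simp
    then have "emb y \<in> lie_filtration 1"
      unfolding emb_def lie_filtration_def using y(1)
      by (intro sm.lin_ext_in_subspace sm.subspace_span) (auto simp: supported_def)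
    then show ?case using y(2) by simp
  next
    case (Node s t)
    have "commutator (lie_word s \<star> h) (lie_word t) \<in> lie_filtration (Suc (size s + size t))"
      "commutator (lie_word s) (lie_word t \<star> h) \<in> lie_filtration (Suc (size s + size t))"
      using Node by (auto intro!: commutator_in_filtration lie_word_in_filtration)
    then show ?case
      using sm.span_add by (simp add: tensor_star_commutator[OF h] lie_filtration_def)
  qed
  have mono: "g \<in> lie_filtration n" if "g \<in> lie_filtration m" "m \<le> n" for g m
    using that sm.span_mono[of "lie_word ` {t. leaves t \<subseteq> X \<and> size t \<le> m}" "lie_word ` {t. leaves t \<subseteq> X \<and> size t \<le> n}"]
    unfolding lie_filtration_def by fastforce
  show ?thesis
    using f[unfolded lie_filtration_def]
  proof (induction f rule: sm.span_induct_alt)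
    case base
    then show ?case by (simp add: lie_filtration_def sm.span_zero)
  next
    case (step c f g)
    then have "f \<star> h \<in> lie_filtration n" using word mono by auto
    then show ?case using step.IH by (simp add: lie_filtration_def sm.span_add sm.span_scale)
  qed
qed

lemma lie_generated_filtration: "lie_generated X = (\<Union>n. lie_filtration n)"
proof
  show "(\<Union>n. lie_filtration n) \<subseteq> lie_generated X"
    unfolding lie_filtration_def lie_generated_eq_span
    by (intro UN_least sm.span_mono) auto
  have mono: "lie_filtration m \<subseteq> lie_filtration n" if "m \<le> n" for m n
    using that unfolding lie_filtration_def by (intro sm.span_mono image_mono) auto
  show "lie_generated X \<subseteq> (\<Union>n. lie_filtration n)"
    unfolding lie_generated_eq_span
  proof
    fix f :: "('k, 'x) tensor"
    assume "f \<in> sm.span (lie_word ` {t. leaves t \<subseteq> X})"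
    then show "f \<in> (\<Union>n. lie_filtration n)"
    proof (induction f rule: sm.span_induct_alt)
      case base
      then show ?case by (auto simp: lie_filtration_def sm.span_zero)
    next
      case (step c f g)
      then obtain n t where t: "f = lie_word t" "leaves t \<subseteq> X" and g: "g \<in> lie_filtration n"
        by auto
      have "f \<in> lie_filtration (max n (size t))" using t by (simp add: lie_word_in_filtration)
      moreover have "g \<in> lie_filtration (max n (size t))" using g mono[of n "max n (size t)"] by auto
      ultimately have "smul c f + g \<in> lie_filtration (max n (size t))"
        by (simp add: lie_filtration_def sm.span_add sm.span_scale)
      then show ?case by blast
    qed
  qed
qed

lemma tensor_star_lie_closed:
  "f \<in> lie_generated X \<Longrightarrow> h \<in> lie_generated X \<Longrightarrow> f \<star> h \<in> lie_generated X"
  using tensor_star_in_filtration unfolding lie_generated_filtration by blast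

text \<open>The product with a Lie polynomial on the right does not increase the degree, so an induction on
  the degree may use \<open>f \<star> g\<close> and \<open>g \<star> f\<close> as well as \<open>f\<close> and \<open>g\<close> when treating \<open>[f, g]\<close>.\<close>

lemma lie_star_induct [consumes 1, case_names zero add smul letter commutator]:
  assumes h: "h \<in> lie_generated X"
    and zero: "P 0"
    and add: "\<And>f g. f \<in> lie_generated X \<Longrightarrow> g \<in> lie_generated X \<Longrightarrow> P f \<Longrightarrow> P g \<Longrightarrow> P (f + g)"
    and smul: "\<And>c f. f \<in> lie_generated X \<Longrightarrow> P f \<Longrightarrow> P (smul c f)"
    and letter: "\<And>x. x \<in> X \<Longrightarrow> P (Poly_Mapping.single [x] 1)"
    and comm: "\<And>f g. f \<in> lie_generated X \<Longrightarrow> g \<in> lie_generated X \<Longrightarrow> P f \<Longrightarrow> P g \<Longrightarrow>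
      P (f \<star> g) \<Longrightarrow> P (g \<star> f) \<Longrightarrow> P (commutator f g)"
  shows "P h"
proof -
  have span: "P f" if "f \<in> sm.span (lie_word ` S)" "\<And>t. t \<in> S \<Longrightarrow> leaves t \<subseteq> X \<and> P (lie_word t)" for f S
  proof -
    have "f \<in> lie_generated X \<and> P f" using that(1)
    proof (induction f rule: sm.span_induct_alt)
      case base
      then show ?case using zero lie_generated_closed(1) sm.subspace_0 by blast
    next
      case (step c f g)
      then have "f \<in> lie_generated X" "P f" using that(2) by (auto intro: lie_word_in_lie_generated)
      with step show ?case
        by (auto intro!: add smul sm.subspace_add sm.subspace_scale lie_generated_closed(1))
    qed
    then show ?thesis ..
  qed
  have "P (lie_word t)" if "leaves t \<subseteq> X" for t
    using that
  proof (induction "size t" arbitrary: t rule: less_induct)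
    case less
    show ?case
    proof (cases t)
      case (Leaf x)
      with less.prems show ?thesis by (simp add: letter)
    next
      case (Node u v)
      have filt: "P f" if "f \<in> lie_filtration n" "n < size t" for f n
        using that(1) unfolding lie_filtration_def by (rule span) (use that(2) less.hyps in auto)
      have uv: "lie_word u \<in> lie_filtration (size u)" "lie_word v \<in> lie_filtration (size v)"
        using Node less.prems by (auto intro: lie_word_in_filtration)
      then have lie: "(lie_word u :: ('k, 'x) tensor) \<in> lie_generated X"
          "(lie_word v :: ('k, 'x) tensor) \<in> lie_generated X"
        by (auto simp: lie_generated_filtration)
      have "size u < size t" "size v < size t" using Node by simp_all
      then show ?thesis
        using comm[OF lie filt[OF uv(1)] filt[OF uv(2)]
            filt[OF tensor_star_in_filtration[OF uv(1) lie(2)]]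
            filt[OF tensor_star_in_filtration[OF uv(2) lie(1)]]] Node by simp
    qed
  qed
  with h show ?thesis
    unfolding lie_generated_eq_span by (intro span[of h "{t. leaves t \<subseteq> X}"]) auto
qed

lemma tensor_star_commutator_right:
  assumes h: "h \<in> lie_generated X" and k: "k \<in> lie_generated X"
    and letter: "\<And>x. emb x \<star> commutator h k =
      emb x \<star> h \<star> k - emb x \<star> (h \<star> k) - emb x \<star> k \<star> h + emb x \<star> (k \<star> h)"
  shows "f \<star> commutator h k = f \<star> h \<star> k - f \<star> (h \<star> k) - f \<star> k \<star> h + f \<star> (k \<star> h)"
proof (induction f rule: pm_induct)
  case (single w)
  have hk: "h \<star> k \<in> lie_generated X" "k \<star> h \<in> lie_generated X"
    using h k by (simp_all add: tensor_star_lie_closed)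
  have c: "commutator h k \<in> lie_generated X" by (rule lie_generated_closed(2)[OF h k])
  note der = tensor_star_derivation[OF h] tensor_star_derivation[OF k] tensor_star_derivation[OF c]
    tensor_star_derivation[OF hk(1)] tensor_star_derivation[OF hk(2)]
  show ?case
  proof (induction w)
    case Nil
    show ?case
      unfolding tensor_one[symmetric]
      by (simp only: h[THEN tensor_star_one_left] k[THEN tensor_star_one_left] c[THEN tensor_star_one_left]
          hk[THEN tensor_star_one_left] tensor_star_linear) simp
  next
    case (Cons x w)
    have "Poly_Mapping.single (x # w) (1::'k) = emb (Poly_Mapping.single x 1) * Poly_Mapping.single w 1"
      by (simp add: mult_single plus_list_def)
    then show ?case
      by (simp only: der letter Cons.IH tensor_star_linear) (simp add: algebra_simps)
  qed
qed (simp_all add: sm.scale_right_diff_distrib sm.scale_right_distrib)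

lemma tensor_star_emb_mult:
  assumes "h \<in> lie_generated X"
  shows "emb x \<star> (g * h) = emb x \<star> g \<star> h - emb x \<star> (g \<star> h)"
  using assms
proof (induction h arbitrary: x g rule: lie_star_induct)
  case (add f g)
  then show ?case by (simp add: distrib_left)
next
  case (smul c f)
  then show ?case by (simp add: sm.scale_right_diff_distrib)
next
  case (letter y)
  then show ?case using tensor_star_snoc[of mul x g "Poly_Mapping.single y 1"] by simp
next
  case (commutator h k)
  note hk = commutator.hyps
  note IH = commutator.IH
  obtain y where y: "emb x \<star> g = emb y" using tensor_star_emb by blast
  have R: "f \<star> commutator h k = f \<star> h \<star> k - f \<star> (h \<star> k) - f \<star> k \<star> h + f \<star> (k \<star> h)" for f
    by (rule tensor_star_commutator_right[OF hk])
      (simp add: commutator_def tensor_star_diff_right IH)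
  have "emb x \<star> (g * h * k) = emb y \<star> h \<star> k - emb x \<star> (g \<star> h) \<star> k
      - (emb x \<star> (g \<star> k) \<star> h - emb x \<star> (g \<star> k \<star> h)) - (emb y \<star> (h \<star> k) - emb x \<star> (g \<star> (h \<star> k)))"
    by (simp add: IH tensor_star_derivation[OF hk(2)] y tensor_star_diff_left)
  moreover have "emb x \<star> (g * k * h) = emb y \<star> k \<star> h - emb x \<star> (g \<star> k) \<star> h
      - (emb x \<star> (g \<star> h) \<star> k - emb x \<star> (g \<star> h \<star> k)) - (emb y \<star> (k \<star> h) - emb x \<star> (g \<star> (k \<star> h)))"
    by (simp add: IH tensor_star_derivation[OF hk(1)] y tensor_star_diff_left)
  ultimately show ?case
    by (simp add: R[of g] R[of "emb y"] y)
      (simp add: commutator_def right_diff_distrib tensor_star_diff_right mult.assoc[symmetric])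
qed simp

lemma post_lie_algebra_lie_generated:
  "post_lie_algebra smul (lie_generated X) commutator (tensor_star mul)"
proof -
  interpret lie_algebra smul "lie_generated X" commutator
    by (rule lie_algebra_commutator) (simp_all add: lie_generated_closed)
  show ?thesis
  proof unfold_locales
    show "bilinear_on smul (lie_generated X) (tensor_star mul)"
      unfolding bilinear_on_def by (simp add: tensor_star_lie_closed)
    show "f \<star> commutator g h = f \<star> g \<star> h - f \<star> (g \<star> h) - f \<star> h \<star> g + f \<star> (h \<star> g)"
      if "g \<in> lie_generated X" "h \<in> lie_generated X" for f g h
      by (rule tensor_star_commutator_right[OF that])
        (simp add: commutator_def tensor_star_diff_right tensor_star_emb_mult that)
  qed (simp_all add: lie_generated_closed tensor_star_commutator[where X = X])
qed

theorem compatible_on_star_of_letters: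
  fixes scaleL :: "'k::field \<Rightarrow> 'l::ab_group_add \<Rightarrow> 'l"
  assumes L: "post_lie_algebra scaleL L bracketL starL"
    and lin: "linear_on smul scaleL (lie_generated X) L F"
    and brk: "compatible_on (lie_generated X) commutator bracketL F"
    and letters: "\<And>x y. x \<in> X \<Longrightarrow> y \<in> X \<Longrightarrow>
      F (emb (mul (Poly_Mapping.single x 1) (Poly_Mapping.single y 1))) =
        starL (F (Poly_Mapping.single [x] 1)) (F (Poly_Mapping.single [y] 1))"
  shows "compatible_on (lie_generated X) (tensor_star mul) starL F"
proof -
  interpret L: post_lie_algebra scaleL L bracketL starL by (rule L)
  let ?G = "lie_generated X :: ('k, 'x) tensor set"
  interpret G: post_lie_algebra smul ?G commutator "tensor_star mul"
    by (rule post_lie_algebra_lie_generated)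
  note F_lin = lin[unfolded linear_on_def]
  have FL: "f \<in> ?G \<Longrightarrow> F f \<in> L" for f using F_lin by blast
  have F_add: "f \<in> ?G \<Longrightarrow> g \<in> ?G \<Longrightarrow> F (f + g) = F f + F g" for f g using F_lin by blast
  have F_smul: "f \<in> ?G \<Longrightarrow> F (smul c f) = scaleL c (F f)" for f c using F_lin by blast
  have F_brk: "f \<in> ?G \<Longrightarrow> g \<in> ?G \<Longrightarrow> F (commutator f g) = bracketL (F f) (F g)" for f g
    using brk by (simp add: compatible_on_def)
  have zero: "0 \<in> ?G" using G.carrier_subspace by (rule sm.subspace_0)
  have F_zero: "F 0 = 0" using F_smul[OF zero, of 0] by simp
  have diff: "f - g \<in> ?G" "F (f - g) = F f - F g" if "f \<in> ?G" "g \<in> ?G" for f g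
  proof -
    show fg: "f - g \<in> ?G" using G.carrier_subspace that by (rule sm.subspace_diff)
    show "F (f - g) = F f - F g" using F_add[OF fg that(2)] by simp
  qed
  have add: "f + g \<in> ?G" if "f \<in> ?G" "g \<in> ?G" for f g
    using G.carrier_subspace that by (rule sm.subspace_add)
  have smul: "smul c f \<in> ?G" if "f \<in> ?G" for f c
    using G.carrier_subspace that by (rule sm.subspace_scale)
  note starL = bilinear_onD[OF L.star_bilinear]
  note star = bilinear_onD(1)[OF G.star_bilinear]
  have starL0: "starL 0 l = 0" "starL l 0 = 0" if "l \<in> L" for l
    using starL(4)[of l l 0] starL(5)[of l l 0] that by simp_all
  have F_letter: "F (tensor_star mul f (Poly_Mapping.single [y] 1)) =
      starL (F f) (F (Poly_Mapping.single [y] 1))" if y: "y \<in> X" and f: "f \<in> ?G" for f y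
  proof -
    let ?y = "Poly_Mapping.single [y] 1 :: ('k, 'x) tensor"
    have yG: "?y \<in> ?G" using lie_word_in_lie_generated[of "Leaf y" X] y by simp
    let ?S = "{f \<in> ?G. F (tensor_star mul f ?y) = starL (F f) (F ?y)}"
    have "?G \<subseteq> ?S"
    proof (rule lie_generated_minimal)
      show "sm.subspace ?S"
        unfolding sm.subspace_def
        by (auto simp: zero F_zero starL0 add smul FL yG F_add F_smul star starL)
      show "commutator f g \<in> ?S" if "f \<in> ?S" "g \<in> ?S" for f g
        using that yG
        by (simp add: G.bracket_closed G.bracket_star L.bracket_star FL F_add F_brk star)
      show "Poly_Mapping.single [x] 1 \<in> ?S" if x: "x \<in> X" for x
        using lie_word_in_lie_generated[of "Leaf x" X] letters[OF x y] x y
          star_extensionD(2)[OF star_extension_tensor_star[OF magmatic],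
            of "Poly_Mapping.single x 1" "Poly_Mapping.single y 1"]
        by (simp add: single_in_supported)
    qed
    with f show ?thesis by blast
  qed
  have "\<forall>f\<in>?G. F (tensor_star mul f h) = starL (F f) (F h)" if "h \<in> ?G" for h
    using that
  proof (induction h rule: lie_star_induct)
    case zero
    then show ?case by (simp add: F_zero starL0 FL)
  next
    case (add f g)
    then show ?case by (simp add: F_add star starL FL)
  next
    case (smul c f)
    then show ?case by (simp add: F_smul star starL FL)
  next
    case (letter y)
    then show ?case by (simp add: F_letter)
  next
    case (commutator h k)
    note hk = commutator.hyps and IH = commutator.IH
    show ?case
    proof
      fix f assume f: "f \<in> ?G"
      have G: "tensor_star mul (tensor_star mul f h) k \<in> ?G" "tensor_star mul f (tensor_star mul h k) \<in> ?G"
        "tensor_star mul (tensor_star mul f k) h \<in> ?G" "tensor_star mul f (tensor_star mul k h) \<in> ?G"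
        using f hk by (simp_all add: star)
      show "F (tensor_star mul f (commutator h k)) = starL (F f) (F (commutator h k))"
        unfolding G.star_bracket[OF f hk] F_brk[OF hk] L.star_bracket[OF f[THEN FL] hk[THEN FL]]
        using f hk IH by (simp add: diff F_add G star)
    qed
  qed
  then show ?thesis by (simp add: compatible_on_def)
qed

end

section \<open>Freeness of the Lie algebra of Lie polynomials\<close>

subsection \<open>Elimination of a letter\<close>

text \<open>In a Lie algebra, a bracketing of letters, one of which is \<open>a\<close>, is a multiple of \<open>a\<close> plus a
  combination of bracketings of the elements \<open>ad(a)\<^sup>n(x)\<close> with \<open>x \<noteq> a\<close>. These elements are
  encoded by new letters: \<open>inc x\<close> stands for \<open>x\<close>, and \<open>s z\<close> for \<open>ad(a)(z)\<close>.\<close>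

primrec tree_shift :: "('x \<Rightarrow> 'x) \<Rightarrow> 'x mtree \<Rightarrow> ('x mtree \<Rightarrow>\<^sub>0 'k::field)" where
  "tree_shift s (Leaf y) = Poly_Mapping.single (Leaf (s y)) 1"
| "tree_shift s (Node t u) = mag_mul (tree_shift s t) (Poly_Mapping.single u 1)
     + mag_mul (Poly_Mapping.single t 1) (tree_shift s u)"

definition mag_shift :: "('x \<Rightarrow> 'x) \<Rightarrow> ('x mtree \<Rightarrow>\<^sub>0 'k::field) \<Rightarrow> ('x mtree \<Rightarrow>\<^sub>0 'k)" where
  "mag_shift s = lin_ext smul (tree_shift s)"

primrec leaf_coeff :: "'x \<Rightarrow> 'x mtree \<Rightarrow> 'k::field" where
  "leaf_coeff a (Leaf x) = (if x = a then 1 else 0)"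
| "leaf_coeff a (Node t u) = 0"

primrec elim :: "'x \<Rightarrow> ('x \<Rightarrow> 'x) \<Rightarrow> ('x \<Rightarrow> 'x) \<Rightarrow> 'x mtree \<Rightarrow> ('x mtree \<Rightarrow>\<^sub>0 'k::field)" where
  "elim a inc s (Leaf x) = (if x = a then 0 else Poly_Mapping.single (Leaf (inc x)) 1)"
| "elim a inc s (Node t u) = smul (leaf_coeff a t) (mag_shift s (elim a inc s u))
     - smul (leaf_coeff a u) (mag_shift s (elim a inc s t)) + mag_mul (elim a inc s t) (elim a inc s u)"

lemma lin_ext_supported:
  assumes "f \<in> supported X" "\<And>x. x \<in> X \<Longrightarrow> \<phi> x \<in> supported Y"
  shows "lin_ext smul \<phi> f \<in> supported Y"
  using assms by (intro sm.lin_ext_in_subspace[OF subspace_supported]) (auto simp: supported_def)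

lemma mag_mul_supported:
  assumes "f \<in> supported X" "g \<in> supported Y" "\<And>t u. t \<in> X \<Longrightarrow> u \<in> Y \<Longrightarrow> Node t u \<in> Z"
  shows "mag_mul f g \<in> supported Z"
  unfolding mag_mul_def using assms by (intro lin_ext_supported single_in_supported)

lemma supported_mono: "f \<in> supported X \<Longrightarrow> X \<subseteq> Y \<Longrightarrow> f \<in> supported Y"
  by (auto simp: supported_def)

lemma tree_shift_supported: "tree_shift s t \<in> supported {u. size u = size t}"
proof (induction t)
  case (Node t u)
  show ?case
    unfolding tree_shift.simps
    by (intro sm.subspace_add[OF subspace_supported]
        mag_mul_supported[OF Node.IH(1) single_in_supported[where X = "{u}"]]
        mag_mul_supported[OF single_in_supported[where X = "{t}"] Node.IH(2)]) auto
qed (simp add: single_in_supported)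

lemma mag_shift_supported:
  "p \<in> supported {u. size u + c \<le> n} \<Longrightarrow> mag_shift s p \<in> supported {u. size u + c \<le> n}"
  unfolding mag_shift_def
  by (erule lin_ext_supported) (rule supported_mono[OF tree_shift_supported], auto)

lemma elim_supported:
  "(elim a inc s t :: 'x mtree \<Rightarrow>\<^sub>0 'k::field) \<in>
    supported {u. size u + (if a \<in> leaves t then 1 else 0) \<le> size t}"
proof (induction t)
  case (Leaf x)
  then show ?case by (simp add: single_in_supported)
next
  case (Node t u)
  let ?S = "supported {v. size v + (if a \<in> leaves (Node t u) then 1 else 0) \<le> size (Node t u)}
    :: ('x mtree \<Rightarrow>\<^sub>0 'k) set"
  have "mag_mul (elim a inc s t) (elim a inc s u) \<in> ?S"
    by (rule mag_mul_supported[OF Node.IH]) (auto split: if_splits)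
  moreover have "mag_shift s (elim a inc s t) \<in> ?S"
    by (rule supported_mono[OF mag_shift_supported[OF Node.IH(1)]]) auto
  moreover have "mag_shift s (elim a inc s u) \<in> ?S"
    by (rule supported_mono[OF mag_shift_supported[OF Node.IH(2)]]) auto
  ultimately show ?case
    unfolding elim.simps
    by (intro sm.subspace_add[OF subspace_supported] sm.subspace_diff[OF subspace_supported]
        sm.subspace_scale[OF subspace_supported])
qed

lemma (in vector_space) lin_ext_leaf_coeff:
  "lin_ext scale (\<lambda>t. scale (leaf_coeff a t) v) p = scale (Poly_Mapping.lookup p (Leaf a)) v"
proof (induction p rule: pm_induct)
  case (single t)
  show ?case by (cases t) (simp_all add: lookup_single)
qed (simp_all add: lin_ext_add lin_ext_smul lookup_add scale_left_distrib)

lemma (in vector_space) lin_ext_lin_ext: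
  "lin_ext scale \<phi> (lin_ext smul \<psi> p) = lin_ext scale (\<lambda>x. lin_ext scale \<phi> (\<psi> x)) p"
  by (induction p rule: pm_induct) (simp_all add: lin_ext_add lin_ext_smul sm.lin_ext_add sm.lin_ext_smul)

context lie_algebra
begin

lemma lin_ext_tree_eval_shift:
  assumes a: "a \<in> A" and \<psi>: "\<And>y. \<psi> y \<in> A" and s: "\<And>y. \<psi> (s y) = bracket a (\<psi> y)"
  shows "lin_ext scale (tree_eval bracket \<psi>) (mag_shift s p) =
    bracket a (lin_ext scale (tree_eval bracket \<psi>) p)"
proof -
  note E = lin_ext_tree_eval_mag_mul[of \<psi>, OF \<psi>] tree_eval_closed[of \<psi>, OF \<psi>]
    lin_ext_tree_eval_closed[of \<psi>, OF \<psi>]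
  have tree: "lin_ext scale (tree_eval bracket \<psi>) (tree_shift s t) = bracket a (tree_eval bracket \<psi> t)" for t
  proof (induction t)
    case (Node t u)
    then show ?case
      using bracket_derivation[OF a E(2) E(2), of t u] by (simp add: lin_ext_add E)
  qed (simp add: s)
  show ?thesis
    by (induction p rule: pm_induct)
      (simp_all add: mag_shift_def lin_ext_add lin_ext_smul sm.lin_ext_add sm.lin_ext_smul tree E bracket_zero_right
        bracket_add_right bracket_scale_right a)
qed

lemma tree_eval_elim:
  assumes \<phi>: "\<And>x. \<phi> x \<in> A" and \<psi>: "\<And>y. \<psi> y \<in> A"
    and s: "\<And>y. \<psi> (s y) = bracket (\<phi> a) (\<psi> y)" and inc: "\<And>x. \<psi> (inc x) = \<phi> x"
  shows "tree_eval bracket \<phi> t =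
    scale (leaf_coeff a t) (\<phi> a) + lin_ext scale (tree_eval bracket \<psi>) (elim a inc s t)"
proof (induction t)
  case (Leaf x)
  then show ?case by (simp add: inc)
next
  case (Node t u)
  let ?E = "lin_ext scale (tree_eval bracket \<psi>)"
  have E: "?E p \<in> A" for p by (rule lin_ext_tree_eval_closed[of \<psi>, OF \<psi>])
  have diff: "?E (p - q) = ?E p - ?E q" for p q
    using lin_ext_add[of _ "p - q" q] by simp
  have anti: "bracket (?E (elim a inc s t)) (\<phi> a) = - bracket (\<phi> a) (?E (elim a inc s t))"
    by (rule bracket_antisym[OF \<phi> E])
  show ?case
    unfolding tree_eval.simps Node.IH
    by (simp add: bracket_add_left bracket_add_right bracket_scale_left bracket_scale_right \<phi> E
        subspace_add[OF lie_carrier_subspace] subspace_scale[OF lie_carrier_subspace] bracket_alternating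
        lin_ext_add lin_ext_smul diff lin_ext_tree_eval_shift[of "\<phi> a" \<psi> s, OF \<phi> \<psi> s]
        lin_ext_tree_eval_mag_mul[of \<psi>, OF \<psi>] anti)
qed

end

subsection \<open>Action on the words in the new letters\<close>

primrec shift_word :: "('x \<Rightarrow> 'x) \<Rightarrow> 'x list \<Rightarrow> ('k::field, 'x) tensor" where
  "shift_word s [] = 0"
| "shift_word s (y # w) =
     Poly_Mapping.single (s y # w) 1 + Poly_Mapping.single [y] 1 * shift_word s w"

definition tensor_shift :: "('x \<Rightarrow> 'x) \<Rightarrow> ('k::field, 'x) tensor \<Rightarrow> ('k, 'x) tensor" where
  "tensor_shift s = lin_ext smul (shift_word s)"

lemma tensor_shift_linear [simp]:
  "tensor_shift s (f + g) = tensor_shift s f + tensor_shift s g"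
  "tensor_shift s (smul c f) = smul c (tensor_shift s f)"
  "tensor_shift s (Poly_Mapping.single w 1) = shift_word s w"
  "tensor_shift s 0 = 0"
  by (simp_all add: tensor_shift_def sm.lin_ext_add sm.lin_ext_smul)

lemma tensor_shift_one [simp]: "tensor_shift s 1 = 0"
  by (simp add: tensor_one del: single_one)

lemma tensor_shift_mult: "tensor_shift s (f * g) = tensor_shift s f * g + f * tensor_shift s g"
proof (induction f rule: pm_induct)
  case (single u)
  show ?case
  proof (induction g rule: pm_induct)
    case (single v)
    have "shift_word s (u @ v) = shift_word s u * Poly_Mapping.single v 1
        + Poly_Mapping.single u 1 * shift_word s v"
      by (induction u) (simp_all add: tensor_one[symmetric] distrib_left distrib_right mult_single
          plus_list_def mult.assoc[symmetric] del: single_one)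
    then show ?case by (simp add: mult_single plus_list_def)
  qed (simp_all add: distrib_left sm.scale_right_distrib)
qed (simp_all add: distrib_right sm.scale_right_distrib)

lemma tensor_shift_commutator:
  fixes f g :: "('k::field, 'x) tensor"
  shows "tensor_shift s (commutator f g) = commutator (tensor_shift s f) g + commutator f (tensor_shift s g)"
proof -
  have diff: "tensor_shift s (f - g) = tensor_shift s f - tensor_shift s g" for f g :: "('k, 'x) tensor"
    using tensor_shift_linear(1)[of s "f - g" g] by simp
  show ?thesis
    by (simp add: commutator_def diff tensor_shift_mult)
qed

lemma lin_ext_lie_word_shift:
  fixes p :: "'x mtree \<Rightarrow>\<^sub>0 'k::field"
  shows "lin_ext smul lie_word (mag_shift s p) = tensor_shift s (lin_ext smul lie_word p)"
proof -
  have "lin_ext smul lie_word (tree_shift s t) = tensor_shift s (lie_word t :: ('k, 'x) tensor)" for t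
    by (induction t)
      (simp_all add: sm.lin_ext_add lin_ext_lie_word_mag_mul tensor_shift_commutator)
  then show ?thesis
    by (induction p rule: pm_induct) (simp_all add: mag_shift_def sm.lin_ext_add sm.lin_ext_smul)
qed

context
  fixes a :: 'x and inc s :: "'x \<Rightarrow> 'x"
begin

primrec elim_act_word :: "'x list \<Rightarrow> ('k::field, 'x) tensor \<Rightarrow> ('k, 'x) tensor" where
  "elim_act_word [] m = m"
| "elim_act_word (x # w) m =
     (if x = a then tensor_shift s (elim_act_word w m)
      else Poly_Mapping.single [inc x] 1 * elim_act_word w m)"

definition elim_act :: "('k::field, 'x) tensor \<Rightarrow> ('k, 'x) tensor \<Rightarrow> ('k, 'x) tensor" where
  "elim_act f m = lin_ext smul (\<lambda>w. elim_act_word w m) f"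

lemma elim_act_linear [simp]:
  "elim_act (f + g) m = elim_act f m + elim_act g m"
  "elim_act (smul c f) m = smul c (elim_act f m)"
  "elim_act 0 m = 0"
  "elim_act (Poly_Mapping.single w 1) m = elim_act_word w m"
  by (simp_all add: elim_act_def sm.lin_ext_add sm.lin_ext_smul)

lemma elim_act_diff: "elim_act (f - g) m = elim_act f m - elim_act g m"
  using elim_act_linear(1)[of "f - g" g] by simp

lemma elim_act_linear_right [simp]:
  fixes f m n :: "('k::field, 'x) tensor"
  shows
  "elim_act f (m + n) = elim_act f m + elim_act f n"
  "elim_act f (smul c m) = smul c (elim_act f m)"
  "elim_act f 0 = 0"
proof -
  have "elim_act_word w (m + n) = elim_act_word w m + elim_act_word w n"
    "elim_act_word w (smul c m) = smul c (elim_act_word w m)" for w and m n :: "('k, 'x) tensor" and c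
    by (induction w) (simp_all add: distrib_left)
  then show "elim_act f (m + n) = elim_act f m + elim_act f n"
    and smul: "elim_act f (smul c m) = smul c (elim_act f m)" for c m
    by (simp_all add: elim_act_def sm.lin_ext_fun_add sm.lin_ext_fun_smul)
  show "elim_act f 0 = 0" using smul[of 0 0] by simp
qed

lemma elim_act_mult: "elim_act (f * g) m = elim_act f (elim_act g m)"
proof (induction f rule: pm_induct)
  case (single u)
  show ?case
  proof (induction g rule: pm_induct)
    case (single v)
    have "elim_act_word (u @ v) m = elim_act_word u (elim_act_word v m)"
      by (induction u) simp_all
    then show ?case by (simp add: mult_single plus_list_def)
  qed (simp_all add: distrib_left)
qed (simp_all add: distrib_right)

lemma elim_act_lie_word:
  fixes m :: "('k::field, 'x) tensor"
  shows "elim_act (lie_word t) m =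
    smul (leaf_coeff a t) (tensor_shift s m) + lin_ext smul lie_word (elim a inc s t) * m"
proof (induction t arbitrary: m)
  case (Node t u)
  let ?E = "lin_ext smul lie_word :: _ \<Rightarrow> ('k, 'x) tensor"
  have diff: "?E (p - q) = ?E p - ?E q" for p q
    using sm.lin_ext_add[of lie_word "p - q" q] by simp
  show ?case
    by (simp add: commutator_def[of "lie_word t"] elim_act_diff elim_act_mult Node.IH)
      (simp add: tensor_shift_mult sm.lin_ext_add diff sm.lin_ext_smul lin_ext_lie_word_shift
        lin_ext_lie_word_mag_mul commutator_def algebra_simps sm.scale_right_distrib)
qed simp

lemma lie_word_elim_eq_0:
  assumes "lin_ext smul lie_word p = (0 :: ('k::field, 'x) tensor)"
  shows "lin_ext smul lie_word (lin_ext smul (elim a inc s) p) = (0 :: ('k, 'x) tensor)"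
proof -
  have "elim_act (lin_ext smul lie_word p) 1 = lin_ext smul (\<lambda>t. elim_act (lie_word t) 1) p"
    by (rule lin_ext_linear_comp) simp_all
  also have "\<dots> = lin_ext smul (\<lambda>t. lin_ext smul lie_word (elim a inc s t)) p"
    by (simp only: elim_act_lie_word) simp
  finally show ?thesis using assms by (simp add: sm.lin_ext_lin_ext)
qed

end

lemma lie_word_supported: "lie_word t \<in> supported {w. set w = leaves t}"
proof (induction t)
  case (Node t u)
  show ?case
    unfolding lie_word_simps commutator_def
    by (intro sm.subspace_diff[OF subspace_supported] supported_mult[OF Node.IH(1) Node.IH(2)]
        supported_mult[OF Node.IH(2) Node.IH(1)]) (auto simp: plus_list_def)
qed (simp add: single_in_supported)

lemma leaves_nonempty: "leaves t \<noteq> {}"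
  by (induction t) auto

lemma lookup_lie_word_letter: "Poly_Mapping.lookup (lie_word t :: ('k::field, 'x) tensor) [a] = leaf_coeff a t"
proof (cases t)
  case (Node t1 t2)
  have "lie_word t * lie_word u \<in> (supported {w. length w \<ge> 2} :: ('k, 'x) tensor set)" for t u
  proof (rule supported_mult[OF lie_word_supported lie_word_supported])
    fix v w assume "v \<in> {w. set w = leaves t}" "w \<in> {w. set w = leaves u}"
    then show "v + w \<in> {w. length w \<ge> 2}"
      using leaves_nonempty[of t] leaves_nonempty[of u] by (cases v; cases w) (auto simp: plus_list_def)
  qed
  then have "lie_word t \<in> (supported {w. length w \<ge> 2} :: ('k, 'x) tensor set)"
    unfolding Node lie_word_simps commutator_def by (intro sm.subspace_diff[OF subspace_supported])
  then have "[a] \<notin> Poly_Mapping.keys (lie_word t :: ('k, 'x) tensor)" by (auto simp: supported_def)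
  then show ?thesis by (simp add: Node in_keys_iff)
qed (simp add: lookup_single)

lemma lookup_lin_ext_lie_word_letter:
  "Poly_Mapping.lookup (lin_ext smul lie_word p) [a] = Poly_Mapping.lookup p (Leaf a)"
proof (induction p rule: pm_induct)
  case (single t)
  show ?case by (cases t) (simp_all add: lookup_lie_word_letter lookup_single del: lie_word_simps)
qed (simp_all add: sm.lin_ext_add sm.lin_ext_smul lookup_add)

definition part :: "('x \<Rightarrow> bool) \<Rightarrow> ('x \<Rightarrow>\<^sub>0 'k::field) \<Rightarrow> ('x \<Rightarrow>\<^sub>0 'k)" where
  "part P = lin_ext smul (\<lambda>x. if P x then Poly_Mapping.single x 1 else 0)"

lemma part_linear [simp]:
  "part P (f + g) = part P f + part P g" "part P (smul c f) = smul c (part P f)" "part P 0 = 0"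
  "part P (Poly_Mapping.single x 1) = (if P x then Poly_Mapping.single x 1 else 0)"
  by (simp_all add: part_def sm.lin_ext_add sm.lin_ext_smul)

lemma part_add_part_not: "part P f + part (\<lambda>x. \<not> P x) f = f"
  by (induction f rule: pm_induct) (simp_all add: algebra_simps sm.scale_right_distrib[symmetric])

lemma part_supported: "f \<in> supported X \<Longrightarrow> part P f \<in> supported {x \<in> X. P x}"
  unfolding part_def by (erule lin_ext_supported) (simp add: single_in_supported)

lemma part_of_supported:
  assumes "f \<in> supported X" "\<And>x. x \<in> X \<Longrightarrow> P x = b"
  shows "part P f = (if b then f else 0)"
  using assms by (induction f rule: supported_induct) (simp_all split: if_splits)

lemma part_lin_ext_lie_word:
  fixes p :: "'x mtree \<Rightarrow>\<^sub>0 'k::field"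
  shows "part (\<lambda>w. a \<in> set w) (lin_ext smul lie_word p) = lin_ext smul lie_word (part (\<lambda>t. a \<in> leaves t) p)"
proof (induction p rule: pm_induct)
  case (single t)
  have "part (\<lambda>w. a \<in> set w) (lie_word t :: ('k, 'x) tensor) = (if a \<in> leaves t then lie_word t else 0)"
    by (rule part_of_supported[OF lie_word_supported]) simp
  then show ?case by simp
qed (simp_all add: sm.lin_ext_add sm.lin_ext_smul)

text \<open>The hypothesis on \<open>code\<close> makes room for the letters needed by the elimination:
  \<open>code (n, x)\<close> stands for \<open>ad(a)\<^sup>n(x)\<close>.\<close>

theorem (in lie_algebra) lin_ext_tree_eval_eq_0:
  fixes code :: "nat \<times> 'x \<Rightarrow> 'x" and \<phi> :: "'x \<Rightarrow> 'a"
  assumes code: "inj code"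
    and \<phi>: "\<And>x. \<phi> x \<in> A"
    and p: "lin_ext smul lie_word p = 0"
  shows "lin_ext scale (tree_eval bracket \<phi>) p = 0"
proof -
  have bounded: "lin_ext scale (tree_eval bracket \<phi>) p = 0"
    if "p \<in> supported {t. size t < n}" "lin_ext smul lie_word p = 0" "\<And>x. \<phi> x \<in> A" for n p and \<phi> :: "'x \<Rightarrow> 'a"
    using that
  proof (induction n arbitrary: p \<phi>)
    case 0
    then have "p = 0" by (simp add: supported_def)
    then show ?case by simp
  next
    case (Suc n)
    note \<phi> = Suc.prems(3)
    have "lin_ext scale (tree_eval bracket \<phi>) p = 0"
      if "finite S" "p \<in> supported {t. size t < Suc n \<and> leaves t \<subseteq> S}" "lin_ext smul lie_word p = 0" for S p
      using that
    proof (induction S arbitrary: p rule: finite_induct)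
      case empty
      then have "p = 0" by (simp add: supported_def leaves_nonempty)
      then show ?case by simp
    next
      case (insert a S)
      let ?P = "\<lambda>t. a \<in> leaves t"
      let ?p = "part ?P p"
      have p_a: "lin_ext smul lie_word ?p = 0"
        using insert.prems(2) by (simp add: part_lin_ext_lie_word[symmetric])
      have "lin_ext smul lie_word (part (\<lambda>t. \<not> ?P t) p) = 0"
        using insert.prems(2) p_a sm.lin_ext_add[of lie_word ?p "part (\<lambda>t. \<not> ?P t) p"]
        by (simp add: part_add_part_not)
      moreover have "part (\<lambda>t. \<not> ?P t) p \<in> supported {t. size t < Suc n \<and> leaves t \<subseteq> S}"
        using part_supported[OF insert.prems(1)] by (rule supported_mono) auto
      ultimately have rest: "lin_ext scale (tree_eval bracket \<phi>) (part (\<lambda>t. \<not> ?P t) p) = 0"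
        by (intro insert.IH)
      define s where "s y = code (Suc (fst (inv code y)), snd (inv code y))" for y
      define inc where "inc x = code (0, x)" for x
      define \<psi> where "\<psi> y = (bracket (\<phi> a) ^^ fst (inv code y)) (\<phi> (snd (inv code y)))" for y
      have pow: "(bracket (\<phi> a) ^^ k) (\<phi> x) \<in> A" for k x
        by (induction k) (simp_all add: \<phi> bracket_closed)
      have \<psi>: "\<psi> y \<in> A" "\<psi> (s y) = bracket (\<phi> a) (\<psi> y)" "\<psi> (inc x) = \<phi> x" for x y
        by (simp_all add: \<psi>_def s_def inc_def inv_f_f[OF code] pow)
      let ?q = "lin_ext smul (elim a inc s) ?p"
      have "?p \<in> supported {t. size t < Suc n \<and> ?P t}"
        using part_supported[OF insert.prems(1)] by (rule supported_mono) auto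
      then have q: "?q \<in> supported {t. size t < n}"
        by (rule lin_ext_supported) (rule supported_mono[OF elim_supported], auto)
      have "lin_ext scale (tree_eval bracket \<phi>) ?p =
          scale (Poly_Mapping.lookup ?p (Leaf a)) (\<phi> a) + lin_ext scale (tree_eval bracket \<psi>) ?q"
        unfolding tree_eval_elim[of \<phi> \<psi> s a inc, OF \<phi> \<psi>] lin_ext_fun_add lin_ext_leaf_coeff lin_ext_lin_ext ..
      also have "lin_ext scale (tree_eval bracket \<psi>) ?q = 0"
        using q lie_word_elim_eq_0[OF p_a] \<psi>(1) by (rule Suc.IH)
      also have "Poly_Mapping.lookup ?p (Leaf a) = 0"
        using lookup_lin_ext_lie_word_letter[of ?p a] p_a by simp
      finally have "lin_ext scale (tree_eval bracket \<phi>) ?p = 0" by simp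
      then show ?case
        using rest lin_ext_add[of "tree_eval bracket \<phi>" ?p "part (\<lambda>t. \<not> ?P t) p"]
        by (simp add: part_add_part_not)
    qed
    moreover have "finite (\<Union>t\<in>Poly_Mapping.keys p. leaves t)"
    proof -
      have "finite (leaves t)" for t :: "'x mtree" by (induction t) auto
      then show ?thesis by simp
    qed
    moreover have "p \<in> supported {t. size t < Suc n \<and> leaves t \<subseteq> (\<Union>t\<in>Poly_Mapping.keys p. leaves t)}"
      using Suc.prems(1) by (auto simp: supported_def)
    ultimately show ?case using Suc.prems(2) by blast
  qed
  obtain n where "p \<in> supported {t. size t < n}"
    using finite_nat_set_iff_bounded[of "size ` Poly_Mapping.keys p"] by (auto simp: supported_def)
  then show ?thesis using p \<phi> by (rule bounded)
qed

theorem (in lie_algebra) lie_generated_universal: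
  fixes code :: "nat \<times> 'x \<Rightarrow> 'x" and \<phi> :: "'x \<Rightarrow> 'a"
  assumes code: "inj code" and \<phi>: "\<And>x. \<phi> x \<in> A"
  obtains F where "linear_on smul scale (lie_generated X) A F"
    "compatible_on (lie_generated X) commutator bracket F"
    "\<And>x. F (Poly_Mapping.single [x] 1) = \<phi> x"
proof
  let ?T = "lin_ext smul lie_word :: ('x mtree \<Rightarrow>\<^sub>0 'k) \<Rightarrow> _"
  let ?L = "lin_ext scale (tree_eval bracket \<phi>)"
  define F where "F f = ?L (SOME p. ?T p = f)" for f
  have F: "F (?T p) = ?L p" for p
  proof -
    define q where "q = (SOME q. ?T q = ?T p)"
    have "?T q = ?T p" unfolding q_def by (rule someI[where P = "\<lambda>q. ?T q = ?T p"]) simp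
    then have "?T (q - p) = 0" using sm.lin_ext_add[of lie_word "q - p" p] by simp
    then have "?L (q - p) = 0" by (rule lin_ext_tree_eval_eq_0[OF code \<phi>])
    then show ?thesis
      using lin_ext_add[of "tree_eval bracket \<phi>" "q - p" p] by (simp add: F_def q_def)
  qed
  have "lie_generated X \<subseteq> range ?T"
  proof (rule lie_generated_minimal)
    show "sm.subspace (range ?T)"
      unfolding sm.subspace_def
      by (auto simp: sm.lin_ext_add[symmetric] sm.lin_ext_smul[symmetric] intro: range_eqI[where x = 0])
    show "commutator f g \<in> range ?T" if "f \<in> range ?T" "g \<in> range ?T" for f g
      using that by (auto simp: lin_ext_lie_word_mag_mul[symmetric])
    show "Poly_Mapping.single [x] 1 \<in> range ?T" for x
      by (rule range_eqI[where x = "Poly_Mapping.single (Leaf x) 1"]) simp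
  qed
  then have T: "\<exists>p. f = ?T p" if "f \<in> lie_generated X" for f using that by blast
  have "F f \<in> A" "F (f + g) = F f + F g" "F (smul c f) = scale c (F f)"
    "F (commutator f g) = bracket (F f) (F g)"
    if fg: "f \<in> lie_generated X" "g \<in> lie_generated X" for f g c
  proof -
    obtain p q where f: "f = ?T p" and g: "g = ?T q" using fg[THEN T] by blast
    show "F f \<in> A"
      unfolding f F by (rule lin_ext_tree_eval_closed[of \<phi>, OF \<phi>])
    show "F (f + g) = F f + F g"
      unfolding f g sm.lin_ext_add[symmetric] F by (rule lin_ext_add)
    show "F (smul c f) = scale c (F f)"
      unfolding f sm.lin_ext_smul[symmetric] F by (rule lin_ext_smul)
    show "F (commutator f g) = bracket (F f) (F g)"
      unfolding f g lin_ext_lie_word_mag_mul[symmetric] F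
      by (rule lin_ext_tree_eval_mag_mul[of \<phi>, OF \<phi>])
  qed
  then show "linear_on smul scale (lie_generated X) A F"
    "compatible_on (lie_generated X) commutator bracket F"
    by (auto simp: linear_on_def compatible_on_def)
  show "F (Poly_Mapping.single [x] 1) = \<phi> x" for x
    using F[of "Poly_Mapping.single (Leaf x) 1"] by simp
qed

text \<open>Reserves new letters among the trees for the elimination argument.\<close>

primrec comb :: "nat \<Rightarrow> 'v mtree \<Rightarrow> 'v mtree" where
  "comb 0 t = Node t t"
| "comb (Suc n) t = Node (comb n t) t"

lemma inj_comb: "inj (\<lambda>(n, t). comb n t)"
proof -
  have size: "size t < size (comb n t)" for n and t :: "'a mtree" by (induction n) auto
  have right: "t = u" if "comb m t = comb n u" for m n and t u :: "'a mtree"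
    using that by (cases m; cases n) auto
  have "m = n" if "comb m t = comb n t" for m n and t :: "'a mtree"
    using that
  proof (induction m arbitrary: n)
    case 0
    then show ?case using size[of t] by (cases n) (auto, metis less_irrefl)
  next
    case (Suc m)
    then show ?case using size[of t m] by (cases n) auto
  qed
  with right show ?thesis unfolding inj_def by (clarsimp, metis)
qed

theorem corollary1:
  fixes scaleV :: "'k::field \<Rightarrow> 'v::ab_group_add \<Rightarrow> 'v"
    and B :: "'v set"
  assumes V: "vector_space scaleV"
    and B: "is_basis scaleV B"
  defines "X \<equiv> mag_trees B"
  defines "Lie \<equiv> lie_generated X :: ('k, 'v mtree) tensor set"
  defines "star \<equiv> star_ext X mag_mul"
  shows "post_lie_algebra smul Lie commutator star \<and>
    (\<forall>(scaleL :: 'k \<Rightarrow> 'l::ab_group_add \<Rightarrow> 'l) L bracketL starL \<phi>.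
       post_lie_algebra scaleL L bracketL starL \<longrightarrow>
       Vector_Spaces.linear scaleV scaleL \<phi> \<longrightarrow> range \<phi> \<subseteq> L \<longrightarrow>
       (\<exists>!F. F \<in> extensional Lie \<and>
             post_lie_morphism smul Lie commutator star scaleL L bracketL starL F \<and>
             (\<forall>v. F (emb (mag_of scaleV B v)) = \<phi> v)))"
proof (intro conjI allI impI)
  have magmatic: "magmatic_algebra smul (supported X :: ('v mtree \<Rightarrow>\<^sub>0 'k) set) mag_mul"
    using magmatic_mag[of B] by (simp add: mag_def X_def)
  have Lie_T: "Lie \<subseteq> tensor_algebra X"
    unfolding Lie_def by (rule lie_generated_subset_tensor)
  have star: "star f h = tensor_star mag_mul f h" if "f \<in> Lie" "h \<in> Lie" for f h
    unfolding star_def using that Lie_T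
    by (intro star_ext_unique[OF magmatic star_extension_tensor_star[OF magmatic], symmetric]) auto
  have letter: "Poly_Mapping.single [t] 1 \<in> Lie" if "t \<in> X" for t
    using lie_word_in_lie_generated[of "Leaf t" X] that by (simp add: Lie_def)
  have emb_Lie: "emb f \<in> Lie" if "f \<in> mag B" for f
    using that lie_generated_closed(3)[of f X] by (simp add: Lie_def X_def mag_def)
  have star_emb: "star (emb f) (emb g) = emb (mag_mul f g)" if "f \<in> mag B" "g \<in> mag B" for f g
    using that star_extensionD(2)[OF star_extension_star_ext[OF magmatic], of f g]
    by (simp add: star_def X_def mag_def)
  interpret G: post_lie_algebra smul Lie commutator "tensor_star mag_mul"
    unfolding Lie_def by (rule post_lie_algebra_lie_generated[OF magmatic])
  note closed = bilinear_onD(1)[OF G.star_bilinear]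
  have add: "f + g \<in> Lie" if "f \<in> Lie" "g \<in> Lie" for f g
    using G.carrier_subspace that by (rule sm.subspace_add)
  have smul: "smul c f \<in> Lie" if "f \<in> Lie" for f c
    using G.carrier_subspace that by (rule sm.subspace_scale)
  show "post_lie_algebra smul Lie commutator star"
  proof unfold_locales
    show "bilinear_on smul Lie star"
      unfolding bilinear_on_def by (simp add: star closed add smul)
  qed (simp_all add: star closed G.bracket_closed G.star_bracket G.bracket_star G.carrier_subspace)

  fix scaleL :: "'k \<Rightarrow> 'l \<Rightarrow> 'l" and L bracketL starL \<phi>
  assume L: "post_lie_algebra scaleL L bracketL starL"
    and \<phi>: "Vector_Spaces.linear scaleV scaleL \<phi>" "range \<phi> \<subseteq> L"
  interpret L: post_lie_algebra scaleL L bracketL starL by (rule L)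
  let ?mor = "\<lambda>F. post_lie_morphism smul Lie commutator star scaleL L bracketL starL F \<and>
    (\<forall>v. F (emb (mag_of scaleV B v)) = \<phi> v)"
  let ?magmor = "\<lambda>H. H \<in> extensional (mag B) \<and> linear_on smul scaleL (mag B) L H \<and>
    compatible_on (mag B) mag_mul starL H \<and> (\<forall>v. H (mag_of scaleV B v) = \<phi> v)"
  have mag_ex1: "\<exists>!H. ?magmor H"
    by (rule mag_free[OF V B L.magmatic_algebra_axioms \<phi>])
  then obtain H where H: "?magmor H" by (rule ex1E) blast
  interpret V: vector_space scaleV by (rule V)
  have mag_of: "mag_of scaleV B v \<in> mag B" for v
    unfolding mag_of_def mag_def using V.representation_ne_zero[of B v]
    by (intro sm.subspace_sum[OF subspace_supported] single_in_supported) (auto simp: mag_trees_def)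
  show "\<exists>!F. F \<in> extensional Lie \<and> ?mor F"
  proof (rule ex_ex1I)
    define \<Phi> where "\<Phi> t = (if t \<in> X then H (Poly_Mapping.single t 1) else 0)" for t
    have tree_mag: "Poly_Mapping.single t 1 \<in> (mag B :: ('v mtree \<Rightarrow>\<^sub>0 'k) set)" if "t \<in> X" for t
      using that by (simp add: mag_def X_def single_in_supported)
    have \<Phi>: "\<Phi> t \<in> L" for t
      using H tree_mag L.subspace_0[OF L.carrier_subspace] by (auto simp: \<Phi>_def linear_on_def)
    obtain F where F_lin: "linear_on smul scaleL Lie L F"
      and F_brk: "compatible_on Lie commutator bracketL F"
      and F_letter: "\<And>t. F (Poly_Mapping.single [t] 1) = \<Phi> t"
      unfolding Lie_def by (rule L.lie_generated_universal[of _ \<Phi> X, OF inj_comb \<Phi>]) blast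
    have F_emb: "F (emb f) = H f" if f: "f \<in> mag B" for f
    proof -
      have "F (emb f) = lin_ext scaleL (\<lambda>t. F (emb (Poly_Mapping.single t 1))) f"
        using f[unfolded mag_def] F_lin emb_Lie
        by (intro L.linear_on_supported[where F = "\<lambda>f. F (emb f)"]) (auto simp: linear_on_def mag_def)
      also have "\<dots> = lin_ext scaleL (\<lambda>t. H (Poly_Mapping.single t 1)) f"
        using f by (intro lin_ext_cong) (auto simp: F_letter \<Phi>_def mag_def supported_def X_def)
      also have "\<dots> = H f"
        using f[unfolded mag_def] H
        by (intro L.linear_on_supported[where F = H, symmetric]) (auto simp: linear_on_def mag_def)
      finally show ?thesis .
    qed
    have "compatible_on Lie (tensor_star mag_mul) starL F"
      unfolding Lie_def
    proof (rule compatible_on_star_of_letters[OF magmatic L F_lin[unfolded Lie_def] F_brk[unfolded Lie_def]])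
      fix t u assume tu: "t \<in> X" "u \<in> X"
      show "F (emb (mag_mul (Poly_Mapping.single t 1) (Poly_Mapping.single u 1))) =
          starL (F (Poly_Mapping.single [t] 1)) (F (Poly_Mapping.single [u] 1))"
        unfolding F_emb[OF mag_mul_in_mag[OF tree_mag[OF tu(1)] tree_mag[OF tu(2)]]] F_letter
        using H tree_mag[OF tu(1)] tree_mag[OF tu(2)] tu
        by (simp add: compatible_on_def \<Phi>_def del: mag_mul_linear(7))
    qed
    then have "?mor (restrict F Lie)"
      using F_lin F_brk H
      by (auto simp: post_lie_morphism_def linear_on_def compatible_on_def star closed add smul
          G.bracket_closed emb_Lie F_emb mag_of)
    then show "\<exists>F. F \<in> extensional Lie \<and> ?mor F" by blast
  next
    fix F F' assume F: "F \<in> extensional Lie \<and> ?mor F" and F': "F' \<in> extensional Lie \<and> ?mor F'"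
    have sub: "sm.subspace (mag B)" unfolding mag_def by (rule subspace_supported)
    have "?magmor (restrict (\<lambda>f. G (emb f)) (mag B))" if "?mor G" for G
      using that sm.subspace_add[OF sub] sm.subspace_scale[OF sub]
      by (auto simp: post_lie_morphism_def linear_on_def compatible_on_def emb_Lie star_emb[symmetric]
          mag_mul_in_mag mag_of)
    then have eq: "restrict (\<lambda>f. F (emb f)) (mag B) = restrict (\<lambda>f. F' (emb f)) (mag B)"
      using mag_ex1 F F' by blast
    let ?S = "{f \<in> Lie. F f = F' f}"
    have lin: "linear_on smul scaleL Lie L F" "linear_on smul scaleL Lie L F'"
      and brk: "compatible_on Lie commutator bracketL F" "compatible_on Lie commutator bracketL F'"
      using F F' by (simp_all add: post_lie_morphism_def)
    have "Lie \<subseteq> ?S"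
      unfolding Lie_def
    proof (rule lie_generated_minimal, fold Lie_def)
      have zero: "0 \<in> Lie" using G.carrier_subspace by (rule sm.subspace_0)
      have K0: "K 0 = 0" if "linear_on smul scaleL Lie L K" for K
      proof -
        have "K (smul 0 0) = scaleL 0 (K 0)" using that zero unfolding linear_on_def by blast
        then show ?thesis by simp
      qed
      have "F 0 = F' 0" using K0[OF lin(1)] K0[OF lin(2)] by simp
      then have "F 0 = F' 0" using lin by simp
      then show "sm.subspace ?S"
        using lin zero by (auto simp: sm.subspace_def add smul linear_on_def)
      show "commutator f g \<in> ?S" if "f \<in> ?S" "g \<in> ?S" for f g
        using that brk by (simp add: G.bracket_closed compatible_on_def)
      show "Poly_Mapping.single [t] 1 \<in> ?S" if "t \<in> X" for t
        using fun_cong[OF eq, of "Poly_Mapping.single t 1"] letter[OF that] that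
        by (simp add: mag_def X_def single_in_supported)
    qed
    then show "F = F'"
      using F F' by (intro extensionalityI[of _ Lie]) auto
  qed
qed

end
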